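(* Let $G$ be a finitely generated group acting non-elementarily on a hyperbolic space $X$, and let $g_0\in G$ be an $f$-divergent element for the action, with associated sets $\mathcal H_T(x,y)$ as defined in the context. Let $(w_n^p)_n,(z_n^p)_n$ ($p\in G$) be two independent copies of a Markov chain (or random walk) on $G$ with bounded jumps and irreducibility, satisfying both of the following: \begin{enumerate} \item there exists a constant $T_0$ such that for all $T\ge T_0$ there exist constants $C_0,\epsilon_0>0$ such that for all $p\in G$ and $n\in\mathbb N$, $\mathbb P\big[|\mathcal H_T(p,w_n^p)|\ge\epsilon_0 n\big]\ge 1-C_0e^{-n/C_0}$; \item there exists $T_0'\ge 0$ such that for all $T\ge T_0'$ there exists a constant $C_1>0$ such that for all $o,p\in G$, all $m\in\mathbb N$ and all $t>0$, $\mathbb P\big[|\mathcal H_T(o,p)\cap\mathcal H_T(p,w_m^p)|>t\big]\le C_1e^{-t/C_1}$. \end{enumerate} Then there exists a constant $\delta_0\in(0,1)$ such that for all $0<\delta\le\delta_0$ there exists a constant $C>0$ such that for all $p\in G$ and $n\in\mathbb N$ $$\mathbb P\Big[\mathrm{div}(w_n^p,z_n^p,p;\delta)>n f(n/C)/C\Big]\ge 1-Ce^{-n/C}.$$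
   Context: Setting. $G$ has a fixed word metric $d_G$ (finite generating set); $X$ is a Gromov-hyperbolic space with basepoint $x_0$, rescaled so that $d_X(gx_0,hx_0)\le d_G(g,h)$; non-elementary means that there are two independent loxodromic elements. A path in $G$ is a finite sequence of elements with consecutive ones at $d_G$-distance at most $1$; its length is the number of steps. For $A\subseteq G$, an $X$-projection $\pi:G\to A$ is a map such that for all $h\in G$ the point $\pi(h)x_0$ is a closest point of $Ax_0$ to $hx_0$. $f$-divergence. $f:\mathbb R^+\to\mathbb R^+$ is an increasing diverging function. The element $g_0$ is $f$-divergent for the action if it is loxodromic and there is a constant $\theta$ such that, for a fixed $X$-projection $\pi:G\to\langle g_0\rangle$: if $d_G(\pi(x),\pi(y))\ge\theta$ and $\alpha$ is a path in $G$ from $x$ to $y$ avoiding the $d$-neighborhood of $\langle g_0\rangle$, then $\alpha$ has length at least $f(d)$. Such an element is loxodromic and WPD, and $\gamma=E(g_0)$ denotes the unique maximal elementary (virtually cyclic) subgroup containing $g_0$. Projections. Fix a $\gamma$-equivariant map $\pi_\gamma$ from $G$ to subsets of $\gamma$ and a constant $B$ such that, setting $\pi_{k\gamma}(z)=k\pi_\gamma(k^{-1}z)$, $\pi_{k\gamma}(Y)=\bigcup_{y\in Y}\pi_{k\gamma}(y)$ for $Y\subseteq G$, and $d_{h\gamma}(x,y)=\mathrm{diam}(\pi_{h\gamma}(x)\cup\pi_{h\gamma}(y))$ (diameter measured with $d_X$ via the orbit map $g\mapsto gx_0$; similarly for subsets in place of points): for all $x\in G$ and $h\gamma\ne h'\gamma$,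 $d_{h\gamma}(x,h'\gamma)>B$ implies $\pi_{h'\gamma}(x)=\pi_{h'\gamma}(h\gamma)$; and for all $x$ the Hausdorff distance between $\pi_\gamma(x)$ and an $X$-projection of $x$ to $\langle g_0\rangle$ is at most $B$. (Such a map exists.) For $T\ge0$, $\mathcal H_T(x,y)=\{h\gamma : d_{h\gamma}(x,y)\ge T\}$. Markov chains. A Markov chain on $G$ is time-homogeneous with transition probabilities $p(g,h)$, and $w_n^o$ is its position after $n$ steps started at $o$. Bounded jumps: there is a finite set $S\subseteq G$ with $p(g,h)=0$ if $h\notin gS$. Irreducibility: for all $s\in G$ there are $\epsilon_s,K_s>0$ such that for all $g\in G$, $\mathbb P[w_k^g=gs]\ge\epsilon_s$ for some $k\le K_s$. (A random walk driven by a measure whose finite support generates $G$ as a semigroup is an example.) Divergence. For $0<\delta<1$ and $a,b,c\in G$ with $r=d_G(c,\{a,b\})>0$, $\mathrm{div}(a,b,c;\delta)$ is the infimum of lengths of paths from $a$ to $b$ avoiding the ball $B(c,\delta r)$ ($\infty$ if there is none). If $r=0$ it is undefined and such outcomes are regarded as not belonging to the event in the statement. *)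

theory Defs
  imports "HOL-Probability.Probability" "HOL-Algebra.Algebra"
begin

section \<open>Word metrics, paths and divergence\<close>

definition word_length :: "('g, 'b) monoid_scheme \<Rightarrow> 'g set \<Rightarrow> 'g \<Rightarrow> nat" where
  "word_length G A g =
     (LEAST n. \<exists>xs. length xs = n \<and> set xs \<subseteq> A \<union> m_inv G ` A \<and> foldr (mult G) xs (one G) = g)"

definition word_dist :: "('g, 'b) monoid_scheme \<Rightarrow> 'g set \<Rightarrow> 'g \<Rightarrow> 'g \<Rightarrow> nat" where
  "word_dist G A g h = word_length G A (inv\<^bsub>G\<^esub> g \<otimes>\<^bsub>G\<^esub> h)"

definition is_path :: "('g, 'b) monoid_scheme \<Rightarrow> 'g set \<Rightarrow> 'g \<Rightarrow> 'g \<Rightarrow> 'g list \<Rightarrow> bool" where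
  "is_path G A x y \<alpha> \<longleftrightarrow> \<alpha> \<noteq> [] \<and> hd \<alpha> = x \<and> last \<alpha> = y \<and> set \<alpha> \<subseteq> carrier G \<and>
     successively (\<lambda>u v. word_dist G A u v \<le> 1) \<alpha>"

definition path_length :: "'g list \<Rightarrow> nat" where
  "path_length \<alpha> = length \<alpha> - 1"

definition dist_to_pair :: "('g, 'b) monoid_scheme \<Rightarrow> 'g set \<Rightarrow> 'g \<Rightarrow> 'g \<Rightarrow> 'g \<Rightarrow> nat" where
  "dist_to_pair G A c a b = min (word_dist G A c a) (word_dist G A c b)"

text \<open>The balls avoided are open. The infimum over the empty set is \<open>\<infinity>\<close>. The value is
  meaningful only if \<open>dist_to_pair G A c a b > 0\<close>.\<close>

definition divergence ::
  "('g, 'b) monoid_scheme \<Rightarrow> 'g set \<Rightarrow> 'g \<Rightarrow> 'g \<Rightarrow> 'g \<Rightarrow> real \<Rightarrow> ennreal" where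
  "divergence G A a b c \<delta> =
     (INF \<alpha>\<in>{\<alpha>. is_path G A a b \<alpha> \<and>
                (\<forall>v\<in>set \<alpha>. \<not> real (word_dist G A c v) < \<delta> * real (dist_to_pair G A c a b))}.
        ennreal (real (path_length \<alpha>)))"


section \<open>Hyperbolic spaces and isometric actions\<close>

definition gromov_product :: "'x::metric_space \<Rightarrow> 'x \<Rightarrow> 'x \<Rightarrow> real" where
  "gromov_product b x y = (dist x b + dist y b - dist x y) / 2"

definition gromov_hyperbolic :: "'x::metric_space itself \<Rightarrow> bool" where
  "gromov_hyperbolic TYPE('x) \<longleftrightarrow> (\<exists>\<delta>\<ge>0. \<forall>b x y z::'x.
     gromov_product b x z \<ge> min (gromov_product b x y) (gromov_product b y z) - \<delta>)"

text \<open>Points of the Gromov boundary are represented as classes of sequences converging to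
  infinity.\<close>

definition converges_to_infinity :: "'x::metric_space \<Rightarrow> (nat \<Rightarrow> 'x) \<Rightarrow> bool" where
  "converges_to_infinity b s \<longleftrightarrow>
     filterlim (\<lambda>(i, j). gromov_product b (s i) (s j)) at_top (sequentially \<times>\<^sub>F sequentially)"

definition boundary_point :: "'x::metric_space \<Rightarrow> (nat \<Rightarrow> 'x) \<Rightarrow> (nat \<Rightarrow> 'x) set" where
  "boundary_point b s = {t. converges_to_infinity b t \<and>
     filterlim (\<lambda>(i, j). gromov_product b (s i) (t j)) at_top (sequentially \<times>\<^sub>F sequentially)}"

definition isometric_action ::
  "('g, 'b) monoid_scheme \<Rightarrow> ('g \<Rightarrow> 'x::metric_space \<Rightarrow> 'x) \<Rightarrow> bool" where
  "isometric_action G \<phi> \<longleftrightarrow> group_action G UNIV \<phi> \<and>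
     (\<forall>g\<in>carrier G. \<forall>x y. dist (\<phi> g x) (\<phi> g y) = dist x y)"

text \<open>An element is loxodromic if its orbit map \<open>n \<mapsto> g\<^sup>n x\<^sub>0\<close> is a quasi-isometric embedding of
  the integers.\<close>

definition loxodromic ::
  "('g, 'b) monoid_scheme \<Rightarrow> ('g \<Rightarrow> 'x::metric_space \<Rightarrow> 'x) \<Rightarrow> 'x \<Rightarrow> 'g \<Rightarrow> bool" where
  "loxodromic G \<phi> x0 g \<longleftrightarrow> g \<in> carrier G \<and>
     (\<exists>L\<ge>1. \<forall>m n::int.
        \<bar>of_int m - of_int n\<bar> / L - L \<le> dist (\<phi> (g [^]\<^bsub>G\<^esub> m) x0) (\<phi> (g [^]\<^bsub>G\<^esub> n) x0) \<and>
        dist (\<phi> (g [^]\<^bsub>G\<^esub> m) x0) (\<phi> (g [^]\<^bsub>G\<^esub> n) x0) \<le> L * \<bar>of_int m - of_int n\<bar> + L)"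

definition endpoints ::
  "('g, 'b) monoid_scheme \<Rightarrow> ('g \<Rightarrow> 'x::metric_space \<Rightarrow> 'x) \<Rightarrow> 'x \<Rightarrow> 'g \<Rightarrow> (nat \<Rightarrow> 'x) set set" where
  "endpoints G \<phi> x0 g =
     {boundary_point x0 (\<lambda>n. \<phi> (g [^]\<^bsub>G\<^esub> n) x0),
      boundary_point x0 (\<lambda>n. \<phi> ((inv\<^bsub>G\<^esub> g) [^]\<^bsub>G\<^esub> n) x0)}"

text \<open>Two loxodromic elements are independent if their fixed point sets on the boundary are
  disjoint.\<close>

definition non_elementary ::
  "('g, 'b) monoid_scheme \<Rightarrow> ('g \<Rightarrow> 'x::metric_space \<Rightarrow> 'x) \<Rightarrow> 'x \<Rightarrow> bool" where
  "non_elementary G \<phi> x0 \<longleftrightarrow> (\<exists>g h. loxodromic G \<phi> x0 g \<and> loxodromic G \<phi> x0 h \<and>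
     endpoints G \<phi> x0 g \<inter> endpoints G \<phi> x0 h = {})"


section \<open>Divergent elements and their elementary closures\<close>

definition X_projection ::
  "('g, 'b) monoid_scheme \<Rightarrow> ('g \<Rightarrow> 'x::metric_space \<Rightarrow> 'x) \<Rightarrow> 'x \<Rightarrow> 'g set \<Rightarrow> ('g \<Rightarrow> 'g) \<Rightarrow> bool" where
  "X_projection G \<phi> x0 A \<pi> \<longleftrightarrow> (\<forall>h\<in>carrier G. \<pi> h \<in> A \<and>
     (\<forall>a\<in>A. dist (\<phi> h x0) (\<phi> (\<pi> h) x0) \<le> dist (\<phi> h x0) (\<phi> a x0)))"

text \<open>The neighborhoods avoided are closed.\<close>

definition f_divergent ::
  "('g, 'b) monoid_scheme \<Rightarrow> 'g set \<Rightarrow> ('g \<Rightarrow> 'x::metric_space \<Rightarrow> 'x) \<Rightarrow> 'x \<Rightarrow>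
   (real \<Rightarrow> real) \<Rightarrow> 'g \<Rightarrow> bool" where
  "f_divergent G A \<phi> x0 f g \<longleftrightarrow> loxodromic G \<phi> x0 g \<and>
     (\<exists>\<pi> \<theta>::real. X_projection G \<phi> x0 (generate G {g}) \<pi> \<and>
       (\<forall>x\<in>carrier G. \<forall>y\<in>carrier G. \<forall>d>0. \<forall>\<alpha>.
          real (word_dist G A (\<pi> x) (\<pi> y)) \<ge> \<theta> \<longrightarrow> is_path G A x y \<alpha> \<longrightarrow>
          (\<forall>v\<in>set \<alpha>. \<forall>a\<in>generate G {g}. real (word_dist G A v a) > d) \<longrightarrow>
          real (path_length \<alpha>) \<ge> f d))"

definition virtually_cyclic :: "('g, 'b) monoid_scheme \<Rightarrow> bool" where
  "virtually_cyclic H \<longleftrightarrow> group H \<and>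
     (\<exists>c\<in>carrier H. finite (rcosets\<^bsub>H\<^esub> (generate H {c})))"

definition maximal_elementary :: "('g, 'b) monoid_scheme \<Rightarrow> 'g \<Rightarrow> 'g set \<Rightarrow> bool" where
  "maximal_elementary G g \<gamma> \<longleftrightarrow>
     subgroup \<gamma> G \<and> virtually_cyclic (G\<lparr>carrier := \<gamma>\<rparr>) \<and> g \<in> \<gamma> \<and>
     (\<forall>H. subgroup H G \<longrightarrow> virtually_cyclic (G\<lparr>carrier := H\<rparr>) \<longrightarrow> \<gamma> \<subseteq> H \<longrightarrow> H = \<gamma>)"


section \<open>Projections to cosets\<close>

text \<open>Diameters and Hausdorff distances are measured in the hyperbolic space through the orbit
  map; they are extended-valued.\<close>

definition ediameter :: "'x::metric_space set \<Rightarrow> ennreal" where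
  "ediameter S = (SUP x\<in>S. SUP y\<in>S. ennreal (dist x y))"

definition hausdorff_distance :: "'x::metric_space set \<Rightarrow> 'x set \<Rightarrow> ennreal" where
  "hausdorff_distance S T =
     max (SUP x\<in>S. INF y\<in>T. ennreal (dist x y)) (SUP y\<in>T. INF x\<in>S. ennreal (dist x y))"

text \<open>\<open>coset_proj G \<pi> k Y\<close> is the projection of \<open>Y\<close> to the coset \<open>k\<gamma>\<close>. If \<open>\<pi>\<close> is
  \<open>\<gamma>\<close>-equivariant, it depends only on the coset, and not on the representative \<open>k\<close>; see
  \<open>coset_proj_cong\<close> below.\<close>

definition coset_proj :: "('g, 'b) monoid_scheme \<Rightarrow> ('g \<Rightarrow> 'g set) \<Rightarrow> 'g \<Rightarrow> 'g set \<Rightarrow> 'g set" where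
  "coset_proj G \<pi> k Y = (\<Union>y\<in>Y. k <#\<^bsub>G\<^esub> \<pi> (inv\<^bsub>G\<^esub> k \<otimes>\<^bsub>G\<^esub> y))"

definition coset_dist ::
  "('g, 'b) monoid_scheme \<Rightarrow> ('g \<Rightarrow> 'x::metric_space \<Rightarrow> 'x) \<Rightarrow> 'x \<Rightarrow> ('g \<Rightarrow> 'g set) \<Rightarrow>
   'g \<Rightarrow> 'g set \<Rightarrow> 'g set \<Rightarrow> ennreal" where
  "coset_dist G \<phi> x0 \<pi> h Y Z =
     ediameter ((\<lambda>g. \<phi> g x0) ` (coset_proj G \<pi> h Y \<union> coset_proj G \<pi> h Z))"

definition equivariant_map ::
  "('g, 'b) monoid_scheme \<Rightarrow> 'g set \<Rightarrow> ('g \<Rightarrow> 'g set) \<Rightarrow> bool" where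
  "equivariant_map G \<gamma> \<pi> \<longleftrightarrow> (\<forall>x\<in>carrier G. \<pi> x \<subseteq> \<gamma>) \<and>
     (\<forall>k\<in>\<gamma>. \<forall>x\<in>carrier G. \<pi> (k \<otimes>\<^bsub>G\<^esub> x) = k <#\<^bsub>G\<^esub> \<pi> x)"

definition projection_family ::
  "('g, 'b) monoid_scheme \<Rightarrow> ('g \<Rightarrow> 'x::metric_space \<Rightarrow> 'x) \<Rightarrow> 'x \<Rightarrow> 'g \<Rightarrow> 'g set \<Rightarrow>
   ('g \<Rightarrow> 'g set) \<Rightarrow> real \<Rightarrow> bool" where
  "projection_family G \<phi> x0 g0 \<gamma> \<pi> B \<longleftrightarrow> B \<ge> 0 \<and> equivariant_map G \<gamma> \<pi> \<and>
     (\<forall>x\<in>carrier G. \<forall>h\<in>carrier G. \<forall>h'\<in>carrier G. h <#\<^bsub>G\<^esub> \<gamma> \<noteq> h' <#\<^bsub>G\<^esub> \<gamma> \<longrightarrow>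
        coset_dist G \<phi> x0 \<pi> h {x} (h' <#\<^bsub>G\<^esub> \<gamma>) > ennreal B \<longrightarrow>
        coset_proj G \<pi> h' {x} = coset_proj G \<pi> h' (h <#\<^bsub>G\<^esub> \<gamma>)) \<and>
     (\<exists>\<rho>. X_projection G \<phi> x0 (generate G {g0}) \<rho> \<and>
        (\<forall>x\<in>carrier G.
           hausdorff_distance ((\<lambda>g. \<phi> g x0) ` \<pi> x) ((\<lambda>g. \<phi> g x0) ` {\<rho> x}) \<le> ennreal B))"

lemma (in group) coset_proj_cong:
  assumes \<gamma>: "subgroup \<gamma> G" and eq: "equivariant_map G \<gamma> \<pi>"
    and h: "h \<in> carrier G" and h': "h' \<in> carrier G"
    and cosets: "h <# \<gamma> = h' <# \<gamma>" and Y: "Y \<subseteq> carrier G"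
  shows "coset_proj G \<pi> h Y = coset_proj G \<pi> h' Y"
proof -
  have "h' \<otimes> \<one> \<in> h' <# \<gamma>"
    unfolding l_coset_def by (rule UN_I[OF subgroup.one_closed[OF \<gamma>]]) (rule singletonI)
  then have "h' \<in> h <# \<gamma>"
    unfolding cosets r_one[OF h'] .
  then obtain k where k: "k \<in> \<gamma>" "h' = h \<otimes> k"
    unfolding l_coset_def by blast
  have kc: "k \<in> carrier G" by (rule subgroup.mem_carrier[OF \<gamma> k(1)])
  have ik: "inv k \<in> \<gamma>" by (rule subgroup.m_inv_closed[OF \<gamma> k(1)])
  have "h' \<otimes> inv k = h" unfolding k(2) using kc h by (simp add: m_assoc)
  moreover have "h' <# \<pi> (inv h' \<otimes> y) = (h' \<otimes> inv k) <# \<pi> (inv h \<otimes> y)" if "y \<in> Y" for y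
  proof -
    have y: "y \<in> carrier G" using that Y by (rule subsetD[rotated])
    have c: "inv h \<otimes> y \<in> carrier G" using h y by simp
    have sub: "\<pi> (inv h \<otimes> y) \<subseteq> carrier G"
      using eq c subgroup.subset[OF \<gamma>] unfolding equivariant_map_def by (meson subset_trans)
    have e1: "inv h' \<otimes> y = inv k \<otimes> (inv h \<otimes> y)"
      unfolding k(2) using kc y h by (simp add: inv_mult_group m_assoc)
    have e2: "\<pi> (inv k \<otimes> (inv h \<otimes> y)) = inv k <# \<pi> (inv h \<otimes> y)"
      using eq ik c unfolding equivariant_map_def by simp
    show ?thesis
      unfolding e1 e2 by (rule lcos_m_assoc[OF sub h' inv_closed[OF kc]])
  qed
  ultimately show ?thesis unfolding coset_proj_def by simp
qed

definition large_cosets ::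
  "('g, 'b) monoid_scheme \<Rightarrow> ('g \<Rightarrow> 'x::metric_space \<Rightarrow> 'x) \<Rightarrow> 'x \<Rightarrow> 'g set \<Rightarrow> ('g \<Rightarrow> 'g set) \<Rightarrow>
   real \<Rightarrow> 'g \<Rightarrow> 'g \<Rightarrow> 'g set set" where
  "large_cosets G \<phi> x0 \<gamma> \<pi> T x y =
     {h <#\<^bsub>G\<^esub> \<gamma> |h. h \<in> carrier G \<and> coset_dist G \<phi> x0 \<pi> h {x} {y} \<ge> ennreal T}"

text \<open>Unlike \<open>card\<close>, this assigns \<open>\<infinity>\<close> to infinite sets.\<close>

definition ecard :: "'a set \<Rightarrow> ennreal" where
  "ecard A = emeasure (count_space UNIV) A"


section \<open>Markov chains\<close>

text \<open>\<open>K g\<close> is the distribution of the position after one step from \<open>g\<close>, that is,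
  \<open>p(g,h) = pmf (K g) h\<close>. The process \<open>w o\<close> is the chain started at \<open>o\<close>. The last clause is the
  Markov property with time-homogeneous transition probabilities, written without division by
  the probability of the past.\<close>

definition markov_chain ::
  "('g, 'b) monoid_scheme \<Rightarrow> ('g \<Rightarrow> 'g pmf) \<Rightarrow> 'w measure \<Rightarrow> ('g \<Rightarrow> nat \<Rightarrow> 'w \<Rightarrow> 'g) \<Rightarrow> bool" where
  "markov_chain G K M w \<longleftrightarrow> prob_space M \<and> (\<forall>p\<in>carrier G.
     (\<forall>n. w p n \<in> M \<rightarrow>\<^sub>M count_space (carrier G)) \<and>
     measure M {\<omega>\<in>space M. w p 0 \<omega> = p} = 1 \<and>
     (\<forall>n x. (\<forall>i\<le>Suc n. x i \<in> carrier G) \<longrightarrow>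
        measure M {\<omega>\<in>space M. \<forall>i\<le>Suc n. w p i \<omega> = x i} =
        measure M {\<omega>\<in>space M. \<forall>i\<le>n. w p i \<omega> = x i} * pmf (K (x n)) (x (Suc n))))"

definition bounded_jumps :: "('g, 'b) monoid_scheme \<Rightarrow> ('g \<Rightarrow> 'g pmf) \<Rightarrow> bool" where
  "bounded_jumps G K \<longleftrightarrow> (\<exists>S. finite S \<and> S \<subseteq> carrier G \<and>
     (\<forall>g\<in>carrier G. \<forall>h. h \<notin> g <#\<^bsub>G\<^esub> S \<longrightarrow> pmf (K g) h = 0))"

definition irreducible_chain ::
  "('g, 'b) monoid_scheme \<Rightarrow> 'w measure \<Rightarrow> ('g \<Rightarrow> nat \<Rightarrow> 'w \<Rightarrow> 'g) \<Rightarrow> bool" where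
  "irreducible_chain G M w \<longleftrightarrow> (\<forall>s\<in>carrier G. \<exists>\<epsilon>>0. \<exists>N>0. \<forall>g\<in>carrier G. \<exists>k\<le>N.
     measure M {\<omega>\<in>space M. w g k \<omega> = g \<otimes>\<^bsub>G\<^esub> s} \<ge> \<epsilon>)"

definition independent_processes ::
  "('g, 'b) monoid_scheme \<Rightarrow> 'w measure \<Rightarrow> ('g \<Rightarrow> nat \<Rightarrow> 'w \<Rightarrow> 'g) \<Rightarrow>
   ('g \<Rightarrow> nat \<Rightarrow> 'w \<Rightarrow> 'g) \<Rightarrow> bool" where
  "independent_processes G M w z \<longleftrightarrow> (\<forall>p\<in>carrier G. prob_space.indep_var M
     (Pi\<^sub>M UNIV (\<lambda>_. count_space (carrier G))) (\<lambda>\<omega> n. w p n \<omega>)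
     (Pi\<^sub>M UNIV (\<lambda>_. count_space (carrier G))) (\<lambda>\<omega> n. z p n \<omega>))"

end

theory Submission
  imports Defs
begin

text \<open>
  Project to the cosets \<open>h\<gamma>\<close>. If a path starts at a point whose projection to \<open>h\<gamma>\<close> is far from
  that of \<open>p\<close> and ends at a point whose projection is close to that of \<open>p\<close>, then some stretch of the
  path (its window) has projections at intermediate distance from that of \<open>p\<close> and still moves a
  definite amount in \<open>h\<gamma>\<close>. The Behrstock property makes the windows of distinct cosets disjoint, so
  their lengths add up; by divergence, a window that avoids the \<open>d\<close>-neighborhood of its coset has
  length at least \<open>f d\<close>.

  Let \<open>m\<close> be a small multiple of \<open>n\<close>. There are linearly many cosets with a large projection distance
  between \<open>p\<close> and \<open>w\<^sub>m\<close>. The windows of a geodesic between these points have total length \<open>O(m)\<close>, so at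
  least half of them are of bounded length, and the corresponding cosets pass within \<open>O(m)\<close> of \<open>p\<close>.
  By the second hypothesis and independence, most of these cosets also separate \<open>w\<^sub>n\<close> from both \<open>p\<close>
  and \<open>z\<^sub>n\<close>. A path from \<open>w\<^sub>n\<close> to \<open>z\<^sub>n\<close> that avoids a ball around \<open>p\<close> of radius much larger than \<open>m\<close>
  has a window in each of them, and this window avoids the \<open>m\<close>-neighborhood of the coset, since
  the part of the coset to which it projects lies within \<open>O(m)\<close> of \<open>p\<close>.
\<close>

section \<open>Word metrics\<close>

locale generated_group = group G for G (structure) +
  fixes A :: "'a set"
  assumes A_carrier: "A \<subseteq> carrier G" and generate_A: "generate G A = carrier G"
begin

abbreviation letters where "letters \<equiv> A \<union> m_inv G ` A"
abbreviation wlen where "wlen \<equiv> word_length G A"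
abbreviation wd where "wd \<equiv> word_dist G A"

section \<open>Words in the generators and the word metric\<close>

lemma letters_carrier: "letters \<subseteq> carrier G"
  using A_carrier by auto

lemma foldr_closed: "set xs \<subseteq> carrier G \<Longrightarrow> foldr (\<otimes>) xs \<one> \<in> carrier G"
  by (induction xs) auto

lemma foldr_append_mult:
  "set xs \<subseteq> carrier G \<Longrightarrow> set ys \<subseteq> carrier G \<Longrightarrow>
    foldr (\<otimes>) (xs @ ys) \<one> = foldr (\<otimes>) xs \<one> \<otimes> foldr (\<otimes>) ys \<one>"
  by (induction xs) (auto simp: m_assoc foldr_closed)

lemma inv_foldr:
  "set xs \<subseteq> carrier G \<Longrightarrow>
    inv (foldr (\<otimes>) xs \<one>) = foldr (\<otimes>) (rev (map (m_inv G) xs)) \<one>"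
proof (induction xs)
  case (Cons a xs)
  have "set (rev (map (m_inv G) xs)) \<subseteq> carrier G" "set [inv a] \<subseteq> carrier G"
    using Cons.prems by auto
  from foldr_append_mult[OF this] Cons show ?case
    by (simp add: inv_mult_group foldr_closed)
qed simp

lemma word_exists:
  assumes "g \<in> carrier G"
  shows "\<exists>xs. set xs \<subseteq> letters \<and> foldr (\<otimes>) xs \<one> = g"
proof -
  have "g \<in> generate G A" using assms generate_A by simp
  then show ?thesis
  proof (induction rule: generate.induct)
    case one
    show ?case by (rule exI[of _ "[]"]) simp
  next
    case (incl h)
    then show ?case using A_carrier by (intro exI[of _ "[h]"]) auto
  next
    case (inv h)
    then show ?case using A_carrier by (intro exI[of _ "[inv h]"]) auto
  next
    case (eng h1 h2)
    then obtain xs ys where "set xs \<subseteq> letters" "foldr (\<otimes>) xs \<one> = h1"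
      "set ys \<subseteq> letters" "foldr (\<otimes>) ys \<one> = h2" by blast
    then show ?case
      using letters_carrier foldr_append_mult[of xs ys] by (intro exI[of _ "xs @ ys"]) auto
  qed
qed

lemma shortest_word:
  assumes "g \<in> carrier G"
  obtains xs where "length xs = wlen g" "set xs \<subseteq> letters" "foldr (\<otimes>) xs \<one> = g"
proof -
  have "\<exists>n xs. length xs = n \<and> set xs \<subseteq> letters \<and> foldr (\<otimes>) xs \<one> = g"
    using word_exists[OF assms] by blast
  from LeastI_ex[OF this] show ?thesis
    using that unfolding word_length_def by blast
qed

lemma word_length_le: "set xs \<subseteq> letters \<Longrightarrow> foldr (\<otimes>) xs \<one> = g \<Longrightarrow> wlen g \<le> length xs"
  unfolding word_length_def by (intro Least_le exI[of _ xs] conjI refl)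

lemma word_length_one [simp]: "wlen \<one> = 0"
  using word_length_le[of "[]" \<one>] by simp

lemma word_length_mult:
  assumes "g \<in> carrier G" "h \<in> carrier G"
  shows "wlen (g \<otimes> h) \<le> wlen g + wlen h"
proof -
  obtain xs where "length xs = wlen g" "set xs \<subseteq> letters" "foldr (\<otimes>) xs \<one> = g"
    by (rule shortest_word[OF assms(1)])
  moreover obtain ys where "length ys = wlen h" "set ys \<subseteq> letters" "foldr (\<otimes>) ys \<one> = h"
    by (rule shortest_word[OF assms(2)])
  ultimately show ?thesis
    using letters_carrier foldr_append_mult[of xs ys] word_length_le[of "xs @ ys" "g \<otimes> h"] by auto
qed

lemma word_length_inv_le:
  assumes "g \<in> carrier G"
  shows "wlen (inv g) \<le> wlen g"
proof -
  obtain xs where xs: "length xs = wlen g" "set xs \<subseteq> letters" "foldr (\<otimes>) xs \<one> = g"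
    by (rule shortest_word[OF assms])
  have "foldr (\<otimes>) (rev (map (m_inv G) xs)) \<one> = inv g"
    using inv_foldr[OF subset_trans[OF xs(2) letters_carrier]] unfolding xs(3) by (rule sym)
  moreover have "set (rev (map (m_inv G) xs)) \<subseteq> letters"
  proof -
    have "inv a \<in> letters" if "a \<in> letters" for a
      using that A_carrier by auto
    then have "m_inv G ` set xs \<subseteq> letters" using xs(2) by blast
    then show ?thesis by simp
  qed
  ultimately show ?thesis
    using word_length_le[of "rev (map (m_inv G) xs)" "inv g"] xs(1) by simp
qed

lemma word_length_inv: "g \<in> carrier G \<Longrightarrow> wlen (inv g) = wlen g"
  using word_length_inv_le[of g] word_length_inv_le[of "inv g"] by simp

lemma word_length_nat_pow: "g \<in> carrier G \<Longrightarrow> wlen (g [^] (n::nat)) \<le> n * wlen g"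
proof (induction n)
  case (Suc n)
  then show ?case using word_length_mult[of "g [^] n" g] by simp
qed simp

lemma word_length_int_pow:
  assumes "g \<in> carrier G"
  shows "real (wlen (g [^] (k::int))) \<le> \<bar>of_int k\<bar> * real (wlen g)"
proof -
  have "wlen (g [^] k) \<le> nat \<bar>k\<bar> * wlen g"
  proof (cases "k < 0")
    case True
    have "g [^] k = inv (g [^] nat (- k))"
      unfolding int_pow_def2 if_P[OF True] ..
    then have "wlen (g [^] k) = wlen (g [^] nat (- k))"
      using word_length_inv[OF nat_pow_closed[OF assms]] by (simp only:)
    also have "\<dots> \<le> nat (- k) * wlen g"
      by (rule word_length_nat_pow[OF assms])
    also have "nat (- k) = nat \<bar>k\<bar>" using True by simp
    finally show ?thesis .
  next
    case False
    have "g [^] k = g [^] nat k"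
      unfolding int_pow_def2 if_not_P[OF False] ..
    also have "wlen \<dots> \<le> nat k * wlen g"
      by (rule word_length_nat_pow[OF assms])
    also have "nat k = nat \<bar>k\<bar>" using False by simp
    finally show ?thesis .
  qed
  then have "real (wlen (g [^] k)) \<le> real (nat \<bar>k\<bar> * wlen g)" by (simp only: of_nat_le_iff)
  then show ?thesis by simp
qed

lemma word_dist_self [simp]: "x \<in> carrier G \<Longrightarrow> wd x x = 0"
  by (simp add: word_dist_def)

lemma word_dist_commute:
  assumes "x \<in> carrier G" "y \<in> carrier G"
  shows "wd x y = wd y x"
  using word_length_inv[of "inv x \<otimes> y"] assms by (simp add: word_dist_def inv_mult_group)

lemma word_dist_triangle:
  assumes "x \<in> carrier G" "y \<in> carrier G" "z \<in> carrier G"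
  shows "wd x z \<le> wd x y + wd y z"
proof -
  have "inv x \<otimes> z = (inv x \<otimes> y) \<otimes> (inv y \<otimes> z)"
    using assms by (simp add: m_assoc[symmetric]) (simp add: m_assoc)
  then show ?thesis
    using assms word_length_mult[of "inv x \<otimes> y" "inv y \<otimes> z"] by (simp add: word_dist_def)
qed

lemma word_dist_left_mult:
  assumes "h \<in> carrier G" "x \<in> carrier G" "y \<in> carrier G"
  shows "wd (h \<otimes> x) (h \<otimes> y) = wd x y"
proof -
  have "inv (h \<otimes> x) \<otimes> (h \<otimes> y) = inv x \<otimes> y"
    using assms by (simp add: inv_mult_group m_assoc[symmetric]) (simp add: m_assoc)
  then show ?thesis by (simp add: word_dist_def)
qed

text \<open>The group is the image of the countable set of words. Countability later makes every
  event about finitely many positions of a chain measurable.\<close>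

lemma countable_carrier:
  assumes "finite A"
  shows "countable (carrier G)"
proof -
  have "countable (lists letters)"
    using assms by (intro countable_lists countable_finite) simp
  then have "countable ((\<lambda>xs. foldr (\<otimes>) xs \<one>) ` lists letters)"
    by (rule countable_image)
  moreover have "carrier G \<subseteq> (\<lambda>xs. foldr (\<otimes>) xs \<one>) ` lists letters"
  proof
    fix g assume "g \<in> carrier G"
    then obtain xs where "set xs \<subseteq> letters" "foldr (\<otimes>) xs \<one> = g" using word_exists by blast
    then show "g \<in> (\<lambda>xs. foldr (\<otimes>) xs \<one>) ` lists letters" by (intro image_eqI[of _ _ xs]) auto
  qed
  ultimately show ?thesis
    by (rule countable_subset[rotated])
qed

section \<open>Paths in the group\<close>

lemma path_nth_step: "is_path G A x y \<alpha> \<Longrightarrow> Suc k < length \<alpha> \<Longrightarrow> wd (\<alpha> ! k) (\<alpha> ! Suc k) \<le> 1"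
  by (auto simp: is_path_def successively_conv_nth)

lemma path_nth_carrier: "is_path G A x y \<alpha> \<Longrightarrow> k < length \<alpha> \<Longrightarrow> \<alpha> ! k \<in> carrier G"
  by (auto simp: is_path_def)

lemma path_dist_nth:
  assumes "is_path G A x y \<alpha>" "i \<le> j" "j < length \<alpha>"
  shows "wd (\<alpha> ! i) (\<alpha> ! j) \<le> j - i"
  using assms(2,3)
proof (induction j rule: dec_induct)
  case base
  then show ?case using path_nth_carrier[OF assms(1)] by simp
next
  case (step n)
  then show ?case
    using word_dist_triangle[of "\<alpha> ! i" "\<alpha> ! n" "\<alpha> ! Suc n"] path_nth_carrier[OF assms(1)]
      path_nth_step[OF assms(1), of n] by simp
qed

text \<open>The partial products of a shortest word for \<open>inv x \<otimes> y\<close>, read from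
  \<open>x\<close>, form a path of the right length.\<close>

lemma geodesic_exists:
  assumes "x \<in> carrier G" "y \<in> carrier G"
  obtains \<alpha> where "is_path G A x y \<alpha>" "path_length \<alpha> = wd x y"
proof -
  \<comment> \<open>Stated for every starting point, since removing the first letter moves the
    start.\<close>
  have *: "\<exists>\<alpha>. is_path G A x (x \<otimes> foldr (\<otimes>) xs \<one>) \<alpha> \<and> length \<alpha> = Suc (length xs)"
    if "set xs \<subseteq> letters" "x \<in> carrier G" for xs x
    using that
  proof (induction xs arbitrary: x)
    case Nil
    then show ?case by (intro exI[of _ "[x]"]) (simp add: is_path_def)
  next
    case (Cons a xs)
    have a: "a \<in> carrier G" "set xs \<subseteq> carrier G" using Cons.prems letters_carrier by auto
    then obtain \<alpha> where \<alpha>: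
      "is_path G A (x \<otimes> a) (x \<otimes> a \<otimes> foldr (\<otimes>) xs \<one>) \<alpha>" "length \<alpha> = Suc (length xs)"
      using Cons.IH[of "x \<otimes> a"] Cons.prems by auto
    have "wd x (x \<otimes> a) = wlen a"
      using a Cons.prems by (simp add: word_dist_def m_assoc[symmetric])
    also have "\<dots> \<le> 1" using word_length_le[of "[a]" a] a Cons.prems by auto
    finally show ?case
      using \<alpha> a Cons.prems foldr_closed
      by (intro exI[of _ "x # \<alpha>"]) (auto simp: is_path_def successively_Cons m_assoc)
  qed
  obtain xs where xs: "length xs = wlen (inv x \<otimes> y)" "set xs \<subseteq> letters"
    "foldr (\<otimes>) xs \<one> = inv x \<otimes> y"
    using shortest_word[of "inv x \<otimes> y"] assms by auto
  have "x \<otimes> (inv x \<otimes> y) = y" using assms by (simp add: m_assoc[symmetric])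
  then obtain \<alpha> where "is_path G A x y \<alpha>" "length \<alpha> = Suc (wlen (inv x \<otimes> y))"
    using *[OF xs(2) assms(1)] unfolding xs(1,3) by metis
  then show ?thesis
    by (intro that[of \<alpha>]) (simp_all add: path_length_def word_dist_def)
qed

lemma path_segment:
  assumes "is_path G A x y \<alpha>" "i \<le> j" "j < length \<alpha>"
  defines "\<beta> \<equiv> take (Suc (j - i)) (drop i \<alpha>)"
  shows "is_path G A (\<alpha> ! i) (\<alpha> ! j) \<beta>" "path_length \<beta> = j - i"
    "set \<beta> = {\<alpha> ! k |k. i \<le> k \<and> k \<le> j}"
proof -
  \<comment> \<open>Both ends of the index range belong to the segment: \<open>Suc (j - i)\<close>
    vertices, \<open>j - i\<close> steps.\<close>
  have len: "length \<beta> = Suc (j - i)" using assms by simp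
  have nth: "\<beta> ! k = \<alpha> ! (i + k)" if "k \<le> j - i" for k using that assms by simp
  show "path_length \<beta> = j - i" using len by (simp add: path_length_def)
  show set: "set \<beta> = {\<alpha> ! k |k. i \<le> k \<and> k \<le> j}"
  proof -
    have "set \<beta> = {\<beta> ! k |k. k \<le> j - i}"
      unfolding set_conv_nth len by (auto simp: less_Suc_eq_le)
    also have "\<dots> = {\<alpha> ! k |k. i \<le> k \<and> k \<le> j}"
    proof safe
      fix k assume "k \<le> j - i"
      then show "\<exists>k'. \<beta> ! k = \<alpha> ! k' \<and> i \<le> k' \<and> k' \<le> j"
        using nth assms(2) by (intro exI[of _ "i + k"]) auto
    next
      fix k assume "i \<le> k" "k \<le> j"
      then show "\<exists>k'. \<alpha> ! k = \<beta> ! k' \<and> k' \<le> j - i"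
        using nth[of "k - i"] by (intro exI[of _ "k - i"]) auto
    qed
    finally show ?thesis .
  qed
  have "successively (\<lambda>u v. wd u v \<le> 1) \<beta>"
    unfolding successively_conv_nth
    using nth path_nth_step[OF assms(1)] len assms by auto
  moreover have ne: "\<beta> \<noteq> []" using len by (metis Suc_neq_Zero list.size(3))
  moreover have "hd \<beta> = \<alpha> ! i" using nth[of 0] hd_conv_nth[OF ne] by simp
  moreover have "last \<beta> = \<alpha> ! j"
    using nth[of "j - i"] last_conv_nth[OF ne] assms(2) unfolding len by simp
  ultimately show "is_path G A (\<alpha> ! i) (\<alpha> ! j) \<beta>"
    using set path_nth_carrier[OF assms(1)] assms(3) by (auto simp: is_path_def)
qed

lemma path_left_mult:
  assumes "is_path G A x y \<alpha>" "h \<in> carrier G"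
  shows "is_path G A (h \<otimes> x) (h \<otimes> y) (map (\<lambda>v. h \<otimes> v) \<alpha>)"
proof -
  have \<alpha>: "\<alpha> \<noteq> []" "hd \<alpha> = x" "last \<alpha> = y" "set \<alpha> \<subseteq> carrier G"
    using assms(1) by (simp_all add: is_path_def)
  have "wd (h \<otimes> \<alpha> ! k) (h \<otimes> \<alpha> ! Suc k) \<le> 1" if "Suc k < length \<alpha>" for k
  proof -
    have "wd (h \<otimes> \<alpha> ! k) (h \<otimes> \<alpha> ! Suc k) = wd (\<alpha> ! k) (\<alpha> ! Suc k)"
      using that by (intro word_dist_left_mult assms(2) path_nth_carrier[OF assms(1)]) simp_all
    then show ?thesis using path_nth_step[OF assms(1) that] by simp
  qed
  then have "successively (\<lambda>u v. wd u v \<le> 1) (map ((\<otimes>) h) \<alpha>)"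
    unfolding successively_conv_nth length_map by (auto simp only: nth_map Suc_lessD)
  moreover have "set (map ((\<otimes>) h) \<alpha>) \<subseteq> carrier G"
    unfolding set_map using \<alpha>(4) m_closed[OF assms(2)] by blast
  moreover have "map ((\<otimes>) h) \<alpha> \<noteq> []" using \<alpha>(1) by blast
  moreover have "hd (map ((\<otimes>) h) \<alpha>) = h \<otimes> x"
    unfolding hd_map[OF \<alpha>(1)] \<alpha>(2) ..
  moreover have "last (map ((\<otimes>) h) \<alpha>) = h \<otimes> y"
    unfolding last_map[OF \<alpha>(1)] \<alpha>(3) ..
  ultimately show ?thesis
    unfolding is_path_def by (intro conjI)
qed

end

section \<open>Nearest points on a loxodromic axis\<close>

text \<open>As in Fekete's lemma, the quotients \<open>D n / n\<close> have an infimum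
  \<open>\<tau>\<close>, positive by the linear lower bound. So \<open>D n\<close> is at least
  \<open>\<tau> * n\<close>, while \<open>D k\<close> is at most a slightly larger multiple of
  \<open>k\<close> plus a constant; for \<open>k\<close> about \<open>n / 2\<close> the gain grows
  linearly and exceeds \<open>s\<close>.\<close>

lemma subadditive_halves:
  fixes D :: "nat \<Rightarrow> real"
  assumes nonneg: "\<And>n. D n \<ge> 0" and D0: "D 0 = 0" and subadd: "\<And>m n. D (m + n) \<le> D m + D n"
    and L: "L > 0" and lower: "\<And>n. real n / L - L \<le> D n"
  shows "\<exists>n0. \<forall>n\<ge>n0. D (n div 2) \<le> D n - s \<and> D (n - n div 2) \<le> D n - s"
proof -
  have mult: "D (k * n) \<le> real k * D n" for k n
  proof (induction k)
    case (Suc k)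
    then show ?case using subadd[of n "k * n"] by (simp add: algebra_simps)
  qed (simp add: D0)
  \<comment> \<open>The additive error in \<open>lower\<close> disappears by amplification: a
    deficit at \<open>n\<close> is multiplied by \<open>k\<close> at \<open>k * n\<close>.\<close>
  have lin: "real n / L \<le> D n" for n
  proof (rule ccontr)
    assume "\<not> ?thesis"
    then have gap: "real n / L - D n > 0" by simp
    obtain k :: nat where k: "real k * (real n / L - D n) > L"
      using reals_Archimedean3[OF gap] by blast
    from mult[of k n] lower[of "k * n"] k show False
      by (simp add: algebra_simps)
  qed
  \<comment> \<open>When \<open>D n\<close> is the displacement of the n-th power of
    \<open>g0\<close>, this is the stable translation length.\<close>
  define \<tau> where "\<tau> = (INF n\<in>{1..}. D n / real n)"
  have bdd: "bdd_below ((\<lambda>n. D n / real n) ` {1..})"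
    using nonneg by (intro bdd_belowI[of _ 0]) auto
  have \<tau>_le: "\<tau> * real n \<le> D n" for n
  proof (cases "n = 0")
    case False
    then have "\<tau> \<le> D n / real n"
      unfolding \<tau>_def by (intro cINF_lower[OF bdd]) auto
    then show ?thesis using False by (simp add: field_simps)
  qed (use nonneg in simp)
  have "1 / L \<le> \<tau>"
    unfolding \<tau>_def
  proof (rule cINF_greatest)
    fix n :: nat assume "n \<in> {1..}"
    then show "1 / L \<le> D n / real n" using lin[of n] by (simp add: field_simps)
  qed simp
  moreover have "1 / L > 0" using L by simp
  ultimately have \<tau>: "\<tau> > 0" by linarith
  \<comment> \<open>Any factor strictly between 1 and 2 would do: above 1 so that \<open>N\<close>
    exists, below 2 so that halving the argument gains.\<close>
  have "\<tau> < 5 / 4 * \<tau>" using \<tau> by simp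
  then have "\<exists>N\<in>{1..}. D N / real N < 5 / 4 * \<tau>"
    using cINF_less_iff[OF _ bdd, of "5 / 4 * \<tau>"] unfolding \<tau>_def[symmetric] by simp
  then obtain N where N: "N \<ge> 1" "D N / real N < 5 / 4 * \<tau>" by auto
  define c where "c = real N * D 1"
  \<comment> \<open>Divide \<open>k\<close> by \<open>N\<close>: the multiple of \<open>N\<close>
    costs at most 5/4 of \<open>\<tau>\<close> per unit, the remainder at most
    \<open>c\<close>.\<close>
  have upper: "D k \<le> 5 / 4 * \<tau> * real k + c" for k
  proof -
    have "D (k mod N * 1) \<le> real (k mod N) * D 1" by (intro mult)
    also have "\<dots> \<le> real N * D 1"
      using N nonneg by (intro mult_right_mono) auto
    finally have "D (k mod N) \<le> c" by (simp add: c_def)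
    moreover have "D (k div N * N) \<le> 5 / 4 * \<tau> * real k"
    proof -
      have "D (k div N * N) \<le> real (k div N) * D N" by (intro mult)
      also have "\<dots> \<le> real (k div N) * (5 / 4 * \<tau> * real N)"
        using N by (intro mult_left_mono) (auto simp: field_simps)
      also have "\<dots> = 5 / 4 * \<tau> * real (k div N * N)" by simp
      also have "\<dots> \<le> 5 / 4 * \<tau> * real k"
        using \<tau> by (intro mult_left_mono) (simp_all del: of_nat_mult)
      finally show ?thesis .
    qed
    ultimately show ?thesis
      using subadd[of "k div N * N" "k mod N"] by simp
  qed
  \<comment> \<open>The condition on \<open>k\<close> covers both \<open>n div 2\<close> and
    \<open>n - n div 2\<close>; the linear gain is 1 - 5/8 = 3/8 of
    \<open>\<tau> * n\<close>.\<close>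
  have half: "D k \<le> D n - s"
    if n: "real n \<ge> 8 / (3 * \<tau>) * (s + c + 5 / 8 * \<tau>)" and k: "2 * k \<le> n + 1" for n k
  proof -
    have "s + c + 5 / 8 * \<tau> \<le> 3 / 8 * \<tau> * real n"
      using n \<tau> by (simp add: field_simps)
    moreover have "5 / 4 * \<tau> * real k \<le> 5 / 8 * \<tau> * (real n + 1)"
    proof -
      have "5 / 8 * \<tau> * real (2 * k) \<le> 5 / 8 * \<tau> * real (n + 1)"
      proof (intro mult_left_mono)
        show "real (2 * k) \<le> real (n + 1)" using k by linarith
      qed (use \<tau> in simp)
      then show ?thesis by (simp add: add.commute)
    qed
    ultimately show ?thesis
      using upper[of k] \<tau>_le[of n] by (simp add: algebra_simps)
  qed
  obtain n0 :: nat where n0: "8 / (3 * \<tau>) * (s + c + 5 / 8 * \<tau>) \<le> real n0"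
    using real_arch_simple by blast
  have "D (n div 2) \<le> D n - s \<and> D (n - n div 2) \<le> D n - s" if "n0 \<le> n" for n
  proof -
    have "real n \<ge> 8 / (3 * \<tau>) * (s + c + 5 / 8 * \<tau>)" using n0 that by linarith
    then show ?thesis by (intro conjI half) auto
  qed
  then show ?thesis by blast
qed

text \<open>Twice the Gromov product inequality, with common terms cancelled; the alternatives of
  the minimum become those of the maximum.\<close>

lemma gromov_hyperbolic_four_point:
  assumes "gromov_hyperbolic TYPE('x::metric_space)"
  obtains \<Delta> where "\<Delta> \<ge> 0" "\<And>x y z b::'x.
    dist x z + dist y b \<le> max (dist x y + dist z b) (dist y z + dist x b) + 2 * \<Delta>"
proof -
  obtain \<Delta> where \<Delta>: "\<Delta> \<ge> 0" "\<And>b x y z::'x.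
    gromov_product b x z \<ge> min (gromov_product b x y) (gromov_product b y z) - \<Delta>"
    using assms unfolding gromov_hyperbolic_def by auto
  have "dist x z + dist y b \<le> max (dist x y + dist z b) (dist y z + dist x b) + 2 * \<Delta>"
    for x y z b :: 'x
    using \<Delta>(2)[of b x y z] unfolding gromov_product_def by (auto simp: min_def max_def field_simps split: if_splits)
  then show ?thesis using that \<Delta>(1) by blast
qed

section \<open>The orbit of the cyclic group generated by \<open>g0\<close>\<close>

locale hyperbolic_action = generated_group G A for G (structure) and A +
  fixes \<phi> :: "'a \<Rightarrow> 'x::metric_space \<Rightarrow> 'x" and x0 :: 'x and g0 :: 'a
  assumes hyperbolic: "gromov_hyperbolic TYPE('x)"
    and action: "isometric_action G \<phi>"
    and orbit_lipschitz: "\<lbrakk>g \<in> carrier G; h \<in> carrier G\<rbrakk> \<Longrightarrow>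
      dist (\<phi> g x0) (\<phi> h x0) \<le> real (word_dist G A g h)"
    and loxodromic_g0: "loxodromic G \<phi> x0 g0"
begin

abbreviation dX where "dX g h \<equiv> dist (\<phi> g x0) (\<phi> h x0)"
abbreviation axis where "axis \<equiv> generate G {g0}"

lemma dX_left_mult:
  assumes "k \<in> carrier G" "g \<in> carrier G" "h \<in> carrier G"
  shows "dX (k \<otimes> g) (k \<otimes> h) = dX g h"
proof -
  interpret group_action G UNIV \<phi> using action by (simp add: isometric_action_def)
  show ?thesis
    using action assms composition_rule[of x0 k g] composition_rule[of x0 k h]
    by (simp add: isometric_action_def)
qed

lemma g0_carrier: "g0 \<in> carrier G"
  using loxodromic_g0 by (simp add: loxodromic_def)

lemma axis_eq: "axis = range (\<lambda>k::int. g0 [^] k)"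
  unfolding generate_pow[OF g0_carrier] by auto

lemma axis_carrier: "axis \<subseteq> carrier G"
  unfolding axis_eq using g0_carrier by auto

lemma dX_powers: "dX (g0 [^] (i::int)) (g0 [^] j) = dX \<one> (g0 [^] (j - i))"
proof -
  have "g0 [^] j = g0 [^] i \<otimes> g0 [^] (j - i)"
    using int_pow_mult[OF g0_carrier, of i "j - i"] by simp
  then have "dX (g0 [^] i) (g0 [^] j) = dX (g0 [^] i \<otimes> \<one>) (g0 [^] i \<otimes> g0 [^] (j - i))"
    using g0_carrier by simp
  also have "\<dots> = dX \<one> (g0 [^] (j - i))"
    using g0_carrier by (intro dX_left_mult) auto
  finally show ?thesis .
qed

text \<open>The lower bound in the quasi-isometric embedding controls the exponent difference by
  \<open>dX\<close>, and the word length of a power grows at most linearly in the exponent. On the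
  axis this is a coarse converse of \<open>orbit_lipschitz\<close>.\<close>

lemma word_dist_axis:
  obtains \<kappa> where "\<kappa> > 0" "\<And>a b. a \<in> axis \<Longrightarrow> b \<in> axis \<Longrightarrow> real (wd a b) \<le> \<kappa> * (dX a b + \<kappa>)"
proof -
  obtain L where L: "L \<ge> 1"
    "\<And>m n::int. \<bar>of_int m - of_int n\<bar> / L - L \<le> dX (g0 [^] m) (g0 [^] n)"
    using loxodromic_g0 unfolding loxodromic_def by blast
  \<comment> \<open>One constant serves as factor and as additive error; the \<open>+ 1\<close>
    ensures that it is at least \<open>L\<close>.\<close>
  define \<kappa> where "\<kappa> = (real (wlen g0) + 1) * L"
  have \<kappa>: "L \<le> \<kappa>"
    using L(1) mult_right_mono[of 1 "real (wlen g0) + 1" L] by (simp add: \<kappa>_def)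
  have "real (wd (g0 [^] i) (g0 [^] j)) \<le> \<kappa> * (dX (g0 [^] i) (g0 [^] j) + \<kappa>)" for i j :: int
  proof -
    let ?d = "dX (g0 [^] i) (g0 [^] j)"
    have "inv (g0 [^] i) \<otimes> g0 [^] j = g0 [^] (j - i)"
      using int_pow_mult[OF g0_carrier, of "- i" j] int_pow_neg[OF g0_carrier, of i] by simp
    then have "real (wd (g0 [^] i) (g0 [^] j)) \<le> \<bar>of_int (j - i)\<bar> * real (wlen g0)"
      using word_length_int_pow[OF g0_carrier, of "j - i"] by (simp add: word_dist_def)
    also have "\<dots> \<le> (L * (?d + L)) * (real (wlen g0) + 1)"
    proof (intro mult_mono)
      show "\<bar>of_int (j - i)\<bar> \<le> L * (?d + L)"
        using L(2)[of i j] L(1) by (simp add: field_simps abs_minus_commute)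
    qed (use L(1) in auto)
    also have "\<dots> = \<kappa> * (?d + L)" by (simp add: \<kappa>_def)
    also have "\<dots> \<le> \<kappa> * (?d + \<kappa>)" using \<kappa> L(1) by (intro mult_left_mono) auto
    finally show ?thesis .
  qed
  moreover have "\<kappa> > 0" using \<kappa> L(1) by linarith
  ultimately show ?thesis by (intro that[of \<kappa>]) (auto simp: axis_eq)
qed

text \<open>Approximate midpoints on the axis together with the four-point inequality make nearest
  points coarsely unique.\<close>

lemma near_closest_points_close:
  obtains J where "J \<ge> 0" "\<And>x a b. \<lbrakk>x \<in> carrier G; a \<in> axis; b \<in> axis;
    \<And>c. c \<in> axis \<Longrightarrow> dX x a \<le> dX x c + s; \<And>c. c \<in> axis \<Longrightarrow> dX x b \<le> dX x c + s\<rbrakk> \<Longrightarrow>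
    dX a b \<le> J"
proof -
  obtain \<Delta> where \<Delta>: "\<Delta> \<ge> 0" "\<And>x y z b::'x.
    dist x z + dist y b \<le> max (dist x y + dist z b) (dist y z + dist x b) + 2 * \<Delta>"
    using gromov_hyperbolic_four_point[OF hyperbolic] by blast
  obtain L where L: "L \<ge> 1"
    "\<And>m n::int. \<bar>of_int m - of_int n\<bar> / L - L \<le> dX (g0 [^] m) (g0 [^] n)"
    using loxodromic_g0 unfolding loxodromic_def by blast
  define D where "D n = dX \<one> (g0 [^] int n)" for n
  have D_eq: "dX (g0 [^] i) (g0 [^] j) = D (nat (j - i))" if "i \<le> j" for i j
    using that unfolding D_def dX_powers[of i j] by simp
  have subadd: "D (m + n) \<le> D m + D n" for m n
  proof -
    have "dX (g0 [^] int m) (g0 [^] (int m + int n)) = D n"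
      by (subst D_eq) auto
    then show ?thesis
      using dist_triangle[of "\<phi> \<one> x0" "\<phi> (g0 [^] (int m + int n)) x0" "\<phi> (g0 [^] int m) x0"]
      by (simp add: D_def)
  qed
  have lower: "real n / L - L \<le> D n" for n
    using L(2)[of 0 "int n"] by (simp add: D_def)
  \<comment> \<open>Of the gain, \<open>s\<close> pays for near-minimality,
    \<open>2 * \<Delta>\<close> for the four-point error, and 1 remains for a strict
    contradiction.\<close>
  have "\<exists>n0. \<forall>n\<ge>n0. D (n div 2) \<le> D n - (s + 2 * \<Delta> + 1) \<and>
      D (n - n div 2) \<le> D n - (s + 2 * \<Delta> + 1)"
    using subadd lower L(1) by (intro subadditive_halves[of D L]) (auto simp: D_def)
  then obtain n0 where n0: "\<And>n. n \<ge> n0 \<Longrightarrow> D (n div 2) \<le> D n - (s + 2 * \<Delta> + 1)"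
    "\<And>n. n \<ge> n0 \<Longrightarrow> D (n - n div 2) \<le> D n - (s + 2 * \<Delta> + 1)" by blast
  \<comment> \<open>Only exponent differences up to \<open>n0\<close> can occur, and they give
    finitely many values.\<close>
  define J where "J = Max (D ` {..n0})"
  have J: "D n \<le> J" if "n \<le> n0" for n
    unfolding J_def using that by (intro Max_ge) auto
  have *: "dX (g0 [^] i) (g0 [^] j) \<le> J" if "i \<le> j"
    and i: "\<And>c. c \<in> axis \<Longrightarrow> dX x (g0 [^] i) \<le> dX x c + s"
    and j: "\<And>c. c \<in> axis \<Longrightarrow> dX x (g0 [^] j) \<le> dX x c + s" for x and i j :: int
  proof (cases "nat (j - i) \<le> n0")
    case True
    then show ?thesis using J D_eq[OF that(1)] by simp
  next
    case False
    define n where "n = nat (j - i)"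
    define m where "m = g0 [^] (i + int (n div 2))"
    have mi: "dX (g0 [^] i) m = D (n div 2)"
      unfolding m_def by (subst D_eq) auto
    have mj: "dX m (g0 [^] j) = D (n - n div 2)"
    proof -
      have "i + int (n div 2) \<le> j" "nat (j - (i + int (n div 2))) = n - n div 2"
        using that(1) by (auto simp: n_def nat_diff_distrib)
      then show ?thesis unfolding m_def by (subst D_eq) auto
    qed
    have "m \<in> axis" by (auto simp: m_def axis_eq)
    then have "dX x (g0 [^] i) \<le> dX x m + s" "dX x (g0 [^] j) \<le> dX x m + s"
      using i j by auto
    moreover have "dX (g0 [^] i) (g0 [^] j) = D n" using D_eq[OF that(1)] by (simp add: n_def)
    moreover have "D (n div 2) \<le> D n - (s + 2 * \<Delta> + 1)" "D (n - n div 2) \<le> D n - (s + 2 * \<Delta> + 1)"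
      using n0[of n] False by (auto simp: n_def)
    \<comment> \<open>The four-point inequality for \<open>x\<close>, \<open>m\<close> and the two
      ends, with x-m and end-end on the left: in either alternative the left side exceeds the right
      by at least 1.\<close>
    ultimately have False
      using \<Delta>(2)[of "\<phi> x x0" "\<phi> m x0" "\<phi> (g0 [^] i) x0" "\<phi> (g0 [^] j) x0"] mi mj
      by (simp add: dist_commute)
    then show ?thesis ..
  qed
  have "J \<ge> 0" using J[of 0] by (simp add: D_def)
  then show ?thesis
  proof (rule that)
    fix x a b
    assume a: "a \<in> axis" "\<And>c. c \<in> axis \<Longrightarrow> dX x a \<le> dX x c + s"
      and b: "b \<in> axis" "\<And>c. c \<in> axis \<Longrightarrow> dX x b \<le> dX x c + s"
    obtain i j :: int where ij: "a = g0 [^] i" "b = g0 [^] j" using a(1) b(1) by (auto simp: axis_eq)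
    show "dX a b \<le> J"
    proof (cases "i \<le> j")
      case True
      then show ?thesis using *[OF True a(2)[unfolded ij] b(2)[unfolded ij]] by (simp add: ij)
    next
      case False
      then have "j \<le> i" by simp
      then show ?thesis
        using *[OF _ b(2)[unfolded ij] a(2)[unfolded ij]] by (simp add: ij dist_commute)
    qed
  qed
qed

text \<open>A closest point for \<open>y\<close> is within 2 of optimal for \<open>x\<close>, since
  a change of base point by at most 1 is paid twice. With \<open>x = y\<close> this compares two
  projections; with a single projection it bounds the change along an edge.\<close>

lemma X_projections_close:
  obtains J where "J \<ge> 0" "\<And>\<rho> \<sigma> x y. \<lbrakk>X_projection G \<phi> x0 axis \<rho>; X_projection G \<phi> x0 axis \<sigma>;
    x \<in> carrier G; y \<in> carrier G; dX x y \<le> 1\<rbrakk> \<Longrightarrow> dX (\<rho> x) (\<sigma> y) \<le> J"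
proof -
  obtain J where J: "J \<ge> 0" "\<And>x a b. \<lbrakk>x \<in> carrier G; a \<in> axis; b \<in> axis;
    \<And>c. c \<in> axis \<Longrightarrow> dX x a \<le> dX x c + 2; \<And>c. c \<in> axis \<Longrightarrow> dX x b \<le> dX x c + 2\<rbrakk> \<Longrightarrow>
    dX a b \<le> J"
    using near_closest_points_close[of 2] by blast
  have "dX (\<rho> x) (\<sigma> y) \<le> J" if \<rho>: "X_projection G \<phi> x0 axis \<rho>"
    and \<sigma>: "X_projection G \<phi> x0 axis \<sigma>" and x: "x \<in> carrier G" and y: "y \<in> carrier G"
    and xy: "dX x y \<le> 1" for \<rho> \<sigma> x y
  proof (rule J(2)[OF x])
    show "\<rho> x \<in> axis" "\<sigma> y \<in> axis" using \<rho> \<sigma> x y by (auto simp: X_projection_def)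
    fix c assume c: "c \<in> axis"
    have "dX x (\<rho> x) \<le> dX x c" using \<rho> x c by (auto simp: X_projection_def)
    then show "dX x (\<rho> x) \<le> dX x c + 2" by simp
    have "dX y (\<sigma> y) \<le> dX y c" using \<sigma> y c by (auto simp: X_projection_def)
    then show "dX x (\<sigma> y) \<le> dX x c + 2"
      using xy dist_triangle[of "\<phi> x x0" "\<phi> (\<sigma> y) x0" "\<phi> y x0"]
        dist_triangle[of "\<phi> y x0" "\<phi> c x0" "\<phi> x x0"] by (simp add: dist_commute)
  qed
  then show ?thesis using that J(1) by blast
qed

end

section \<open>Projections to cosets\<close>

lemma descent_window:
  fixes D :: "nat \<Rightarrow> real"
  assumes step: "\<And>k. k < N \<Longrightarrow> \<bar>D (Suc k) - D k\<bar> \<le> J" and J: "J \<le> V" and V: "V > 0"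
    and start: "D 0 \<ge> 3 * V" and "end": "D N < V"
  shows "\<exists>i j. i < j \<and> j \<le> N \<and> D i \<ge> 3 * V \<and> D j \<le> 2 * V \<and> (\<forall>k\<in>{i..j}. V \<le> D k \<and> D k \<le> 4 * V)"
proof -
  define l where "l = (LEAST k. D k < V)"
  have l: "D l < V" unfolding l_def by (rule LeastI[of _ N]) (fact assms)
  have before: "D k \<ge> V" if "k < l" for k
    using not_less_Least[of k "\<lambda>k. D k < V"] that by (simp add: l_def)
  have "l \<le> N" unfolding l_def using assms by (intro Least_le)
  have "l > 0" using l start V by (cases l) auto
  \<comment> \<open>The last index before the first value below \<open>V\<close>; since steps are at
    most \<open>V\<close>, the value here is at most \<open>2 * V\<close>.\<close>
  define j where "j = l - 1"
  have Suc_j: "Suc j = l" using \<open>l > 0\<close> by (simp add: j_def)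
  have j: "D j \<le> 2 * V"
    using step[of j] l J \<open>l \<le> N\<close> Suc_j by auto
  \<comment> \<open>The last index up to \<open>j\<close> at height at least \<open>3 * V\<close>.
    The next value is below \<open>3 * V\<close>, so the value here is at most
    \<open>4 * V\<close>.\<close>
  define i where "i = (GREATEST k. k \<le> j \<and> D k \<ge> 3 * V)"
  have i: "i \<le> j \<and> D i \<ge> 3 * V"
    unfolding i_def
    by (rule GreatestI_nat[of "\<lambda>k. k \<le> j \<and> D k \<ge> 3 * V" 0 j]) (use start in auto)
  have after: "D k < 3 * V" if "i < k" "k \<le> j" for k
  proof (rule ccontr)
    assume "\<not> D k < 3 * V"
    then have "k \<le> i"
      unfolding i_def
      by (intro Greatest_le_nat[of "\<lambda>k. k \<le> j \<and> D k \<ge> 3 * V" k j]) (use that in auto)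
    then show False using that by simp
  qed
  have "i \<noteq> j" using i j V by auto
  then have "i < j" using i by simp
  then have "D i \<le> 4 * V"
    using step[of i] after[of "Suc i"] J \<open>l \<le> N\<close> Suc_j by auto
  then have "V \<le> D k \<and> D k \<le> 4 * V" if "k \<in> {i..j}" for k
    using that before[of k] after[of k] V Suc_j by (cases "k = i") auto
  then show ?thesis
    using \<open>i < j\<close> i j \<open>l \<le> N\<close> Suc_j by (intro exI[of _ i] exI[of _ j]) auto
qed

text \<open>Disjointness makes the left endpoints distinct numbers below \<open>N\<close>, so
  finiteness of the index set is a conclusion and not an assumption.\<close>

lemma disjoint_intervals_total_length:
  fixes I J :: "'c \<Rightarrow> nat"
  assumes IJ: "\<And>C. C \<in> \<C> \<Longrightarrow> I C < J C \<and> J C \<le> N"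
    and disj: "\<And>C C'. C \<in> \<C> \<Longrightarrow> C' \<in> \<C> \<Longrightarrow> C \<noteq> C' \<Longrightarrow> {I C..J C} \<inter> {I C'..J C'} = {}"
  shows "finite \<C>" "(\<Sum>C\<in>\<C>. J C - I C) \<le> N"
proof -
  have "inj_on I \<C>"
  proof (rule inj_onI, rule ccontr)
    fix C C' assume C: "C \<in> \<C>" "C' \<in> \<C>" "I C = I C'" "C \<noteq> C'"
    have "I C \<in> {I C..J C}" "I C' \<in> {I C'..J C'}" using IJ[of C] IJ[of C'] C by auto
    then show False using disj[of C C'] C by auto
  qed
  moreover have "I ` \<C> \<subseteq> {..<N}" using IJ by fastforce
  ultimately show fin: "finite \<C>" using finite_imageD finite_subset by blast
  \<comment> \<open>Half-open intervals have exactly as many elements as the length to be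
    summed.\<close>
  have "(\<Sum>C\<in>\<C>. J C - I C) = (\<Sum>C\<in>\<C>. card {I C..<J C})" by simp
  also have "\<dots> = card (\<Union>C\<in>\<C>. {I C..<J C})"
  proof (intro card_UN_disjoint[symmetric] fin ballI impI)
    fix C C' assume "C \<in> \<C>" "C' \<in> \<C>" "C \<noteq> C'"
    moreover have "{I C..<J C} \<subseteq> {I C..J C}" for C by auto
    ultimately show "{I C..<J C} \<inter> {I C'..<J C'} = {}" using disj[of C C'] by blast
  qed simp
  also have "\<dots> \<le> card {..<N}"
    using IJ by (intro card_mono) fastforce+
  finally show "(\<Sum>C\<in>\<C>. J C - I C) \<le> N" by simp
qed

section \<open>Diameters and single-valued projections\<close>

lemma ediameter_upper: "x \<in> S \<Longrightarrow> y \<in> S \<Longrightarrow> ennreal (dist x y) \<le> ediameter S"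
  unfolding ediameter_def by (intro SUP_upper2[of x] SUP_upper2[of y]) auto

lemma ediameter_least: "(\<And>x y. x \<in> S \<Longrightarrow> y \<in> S \<Longrightarrow> dist x y \<le> r) \<Longrightarrow> ediameter S \<le> ennreal r"
  unfolding ediameter_def by (intro SUP_least ennreal_leI) auto

text \<open>Everything is expressed through one projection \<open>\<sigma>\<close>, the one in the
  divergence condition. The constant \<open>B\<close> need not be the given one: it is enlarged when
  the locale is instantiated, to compare \<open>\<sigma>\<close> with the projection near
  \<open>\<pi>\<close>.\<close>

locale coset_projections = hyperbolic_action G A \<phi> x0 g0
  for G (structure) and A and \<phi> :: "'a \<Rightarrow> 'x::metric_space \<Rightarrow> 'x" and x0 and g0 +
  fixes \<gamma> :: "'a set" and \<pi> :: "'a \<Rightarrow> 'a set" and \<sigma> :: "'a \<Rightarrow> 'a"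
    and f :: "real \<Rightarrow> real" and B J \<theta> :: real
  assumes subgroup_\<gamma>: "subgroup \<gamma> G"
    and equivariant: "equivariant_map G \<gamma> \<pi>"
    and X_projection_\<sigma>: "X_projection G \<phi> x0 axis \<sigma>"
    and \<pi>_nonempty: "x \<in> carrier G \<Longrightarrow> \<pi> x \<noteq> {}"
    and \<pi>_near_\<sigma>: "x \<in> carrier G \<Longrightarrow> u \<in> \<pi> x \<Longrightarrow> dX u (\<sigma> x) \<le> B"
    and \<sigma>_step: "x \<in> carrier G \<Longrightarrow> y \<in> carrier G \<Longrightarrow> dX x y \<le> 1 \<Longrightarrow> dX (\<sigma> x) (\<sigma> y) \<le> J"
    and behrstock: "\<lbrakk>x \<in> carrier G; h \<in> carrier G; h' \<in> carrier G; h <#\<^bsub>G\<^esub> \<gamma> \<noteq> h' <#\<^bsub>G\<^esub> \<gamma>;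
      coset_dist G \<phi> x0 \<pi> h {x} (h' <#\<^bsub>G\<^esub> \<gamma>) > ennreal B\<rbrakk> \<Longrightarrow>
      coset_proj G \<pi> h' {x} = coset_proj G \<pi> h' (h <#\<^bsub>G\<^esub> \<gamma>)"
    and divergent: "\<lbrakk>x \<in> carrier G; y \<in> carrier G; d > 0; real (word_dist G A (\<sigma> x) (\<sigma> y)) \<ge> \<theta>;
      is_path G A x y \<alpha>; \<And>v a. v \<in> set \<alpha> \<Longrightarrow> a \<in> axis \<Longrightarrow> real (word_dist G A v a) > d\<rbrakk> \<Longrightarrow>
      f d \<le> real (path_length \<alpha>)"
begin

text \<open>A point of the axis; the corresponding point near the coset projection of
  \<open>x\<close> is \<open>h \<otimes> pr h x\<close>. As \<open>\<sigma>\<close> is not assumed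
  equivariant, the value depends on \<open>h\<close> and not only on its coset, so representatives
  are fixed by \<open>rep\<close> below.\<close>

definition pr where "pr h x = \<sigma> (inv h \<otimes> x)"
text \<open>A real-valued substitute for \<open>coset_dist\<close> on points, differing from it by
  at most \<open>2 * B\<close>. Being a pulled back distance, it satisfies the triangle inequality
  exactly.\<close>

definition pdist where "pdist h x y = dX (pr h x) (pr h y)"

lemma pdist_nonneg: "pdist h x y \<ge> 0"
  by (simp add: pdist_def)

lemma pdist_self [simp]: "pdist h x x = 0"
  by (simp add: pdist_def)

lemma pdist_commute: "pdist h x y = pdist h y x"
  by (simp add: pdist_def dist_commute)

lemma pdist_triangle: "pdist h x z \<le> pdist h x y + pdist h y z"
  unfolding pdist_def by (rule dist_triangle)

lemma B_nonneg: "B \<ge> 0"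
proof -
  obtain u where "u \<in> \<pi> \<one>" using \<pi>_nonempty[of \<one>] by auto
  then have "dX u (\<sigma> \<one>) \<le> B" using \<pi>_near_\<sigma> by auto
  moreover have "0 \<le> dX u (\<sigma> \<one>)" by simp
  ultimately show ?thesis by linarith
qed

lemma \<sigma>_axis: "x \<in> carrier G \<Longrightarrow> \<sigma> x \<in> axis"
  using X_projection_\<sigma> by (simp add: X_projection_def)

lemma pr_axis: "h \<in> carrier G \<Longrightarrow> x \<in> carrier G \<Longrightarrow> pr h x \<in> axis"
  by (simp add: pr_def \<sigma>_axis)

lemma pr_carrier: "h \<in> carrier G \<Longrightarrow> x \<in> carrier G \<Longrightarrow> pr h x \<in> carrier G"
  using pr_axis axis_carrier by blast

lemma \<gamma>_carrier: "\<gamma> \<subseteq> carrier G"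
  by (rule subgroup.subset[OF subgroup_\<gamma>])

lemma \<pi>_carrier: "x \<in> carrier G \<Longrightarrow> \<pi> x \<subseteq> carrier G"
  using equivariant \<gamma>_carrier by (auto simp: equivariant_map_def)

lemma coset_proj_near:
  assumes "h \<in> carrier G" "x \<in> carrier G" "u \<in> coset_proj G \<pi> h {x}"
  shows "dX u (h \<otimes> pr h x) \<le> B"
proof -
  obtain v where v: "v \<in> \<pi> (inv h \<otimes> x)" "u = h \<otimes> v"
    using assms by (auto simp: coset_proj_def l_coset_def)
  have "inv h \<otimes> x \<in> carrier G" using assms by simp
  then have "dX v (pr h x) \<le> B" "v \<in> carrier G"
    using \<pi>_near_\<sigma> \<pi>_carrier v(1) by (auto simp: pr_def)
  then show ?thesis
    using dX_left_mult[of h v "pr h x"] assms pr_carrier v(2) by simp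
qed

lemma coset_proj_nonempty:
  assumes "h \<in> carrier G" "x \<in> carrier G"
  shows "coset_proj G \<pi> h {x} \<noteq> {}"
  using \<pi>_nonempty[of "inv h \<otimes> x"] assms by (auto simp: coset_proj_def l_coset_def)

lemma pdist_eq:
  assumes "h \<in> carrier G" "x \<in> carrier G" "y \<in> carrier G"
  shows "pdist h x y = dX (h \<otimes> pr h x) (h \<otimes> pr h y)"
  using assms by (simp add: pdist_def dX_left_mult pr_carrier)

lemma pdist_le_of_coset_proj:
  assumes "h \<in> carrier G" "x \<in> carrier G" "y \<in> carrier G"
    and "u \<in> coset_proj G \<pi> h {x}" "v \<in> coset_proj G \<pi> h {y}"
  shows "pdist h x y \<le> dX u v + 2 * B"
  using coset_proj_near[OF assms(1,2,4)] coset_proj_near[OF assms(1,3,5)] pdist_eq[OF assms(1-3)]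
    dist_triangle[of "\<phi> (h \<otimes> pr h x) x0" "\<phi> (h \<otimes> pr h y) x0" "\<phi> u x0"]
    dist_triangle[of "\<phi> u x0" "\<phi> (h \<otimes> pr h y) x0" "\<phi> v x0"]
  by (simp add: dist_commute)

lemma coset_proj_dist_le:
  assumes h: "h \<in> carrier G" "x \<in> carrier G" "y \<in> carrier G"
    and u: "u \<in> coset_proj G \<pi> h {x}" and v: "v \<in> coset_proj G \<pi> h {y}"
  shows "dX u v \<le> pdist h x y + 2 * B"
  using coset_proj_near[OF h(1,2) u] coset_proj_near[OF h(1,3) v] pdist_eq[OF h(1-3)]
    dist_triangle[of "\<phi> u x0" "\<phi> v x0" "\<phi> (h \<otimes> pr h x) x0"]
    dist_triangle[of "\<phi> (h \<otimes> pr h x) x0" "\<phi> v x0" "\<phi> (h \<otimes> pr h y) x0"]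
  by (simp add: dist_commute)

lemma coset_dist_upper:
  assumes "u \<in> coset_proj G \<pi> h Y" "v \<in> coset_proj G \<pi> h Z"
  shows "ennreal (dX u v) \<le> coset_dist G \<phi> x0 \<pi> h Y Z"
  unfolding coset_dist_def using assms by (intro ediameter_upper) auto

lemma coset_dist_le:
  assumes h: "h \<in> carrier G" "x \<in> carrier G" "y \<in> carrier G"
  shows "coset_dist G \<phi> x0 \<pi> h {x} {y} \<le> ennreal (pdist h x y + 2 * B)"
  unfolding coset_dist_def
proof (rule ediameter_least)
  \<comment> \<open>The diameter also compares two points projected from the same element; for these
    \<open>pdist\<close> is 0.\<close>
  have pair: "pdist h s t \<le> pdist h x y" if "s \<in> {x, y}" "t \<in> {x, y}" for s t
    using that pdist_nonneg[of h x y] pdist_commute[of h x y] by auto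
  fix a b
  assume "a \<in> (\<lambda>g. \<phi> g x0) ` (coset_proj G \<pi> h {x} \<union> coset_proj G \<pi> h {y})"
    "b \<in> (\<lambda>g. \<phi> g x0) ` (coset_proj G \<pi> h {x} \<union> coset_proj G \<pi> h {y})"
  then obtain u v s t where "a = \<phi> u x0" "b = \<phi> v x0" and st: "s \<in> {x, y}" "t \<in> {x, y}"
    and uv: "u \<in> coset_proj G \<pi> h {s}" "v \<in> coset_proj G \<pi> h {t}" by blast
  moreover have "s \<in> carrier G" "t \<in> carrier G" using st h by auto
  ultimately show "dist a b \<le> pdist h x y + 2 * B"
    using coset_proj_dist_le[OF h(1) _ _ uv] pair[OF st] by simp
qed

lemma pdist_ge_of_coset_dist:
  assumes "h \<in> carrier G" "x \<in> carrier G" "y \<in> carrier G"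
    and "coset_dist G \<phi> x0 \<pi> h {x} {y} \<ge> ennreal T"
  shows "T - 2 * B \<le> pdist h x y"
proof -
  have "ennreal T \<le> ennreal (pdist h x y + 2 * B)"
    using assms coset_dist_le by (meson order_trans)
  then show ?thesis
    using pdist_nonneg[of h x y] B_nonneg by (simp add: ennreal_le_iff del: ennreal_plus)
qed

lemma pdist_less_of_coset_dist:
  assumes h: "h \<in> carrier G" "x \<in> carrier G" "y \<in> carrier G"
    and less: "\<not> coset_dist G \<phi> x0 \<pi> h {x} {y} \<ge> ennreal U"
  shows "pdist h x y < U + 2 * B"
proof -
  obtain u v where uv: "u \<in> coset_proj G \<pi> h {x}" "v \<in> coset_proj G \<pi> h {y}"
    using coset_proj_nonempty h by blast
  have "ennreal (dX u v) < ennreal U"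
    using coset_dist_upper[OF uv] less by (meson le_less_trans not_le)
  then have "dX u v < U" by (simp add: ennreal_less_iff)
  then show ?thesis using pdist_le_of_coset_proj[OF h uv] by simp
qed

text \<open>At least two of three points that are pairwise far apart in the first coset are far from the
  second coset there; by the Behrstock property they have the same projection to the second one.\<close>

lemma no_common_separated_triple:
  assumes h: "h \<in> carrier G" "h' \<in> carrier G" "h <#\<^bsub>G\<^esub> \<gamma> \<noteq> h' <#\<^bsub>G\<^esub> \<gamma>"
    and x: "x \<in> carrier G" "y \<in> carrier G" "v \<in> carrier G"
    and far: "4 * B < pdist h x y" "4 * B < pdist h y v" "4 * B < pdist h x v"
    and far': "4 * B < pdist h' x y" "4 * B < pdist h' y v" "4 * B < pdist h' x v"
  shows False
proof -
  let ?near = "\<lambda>x. \<not> coset_dist G \<phi> x0 \<pi> h {x} (h' <#\<^bsub>G\<^esub> \<gamma>) > ennreal B"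
  \<comment> \<open>Both projections lie within \<open>B\<close> of a point \<open>c\<close> in the
    projection of the other coset, which gives \<open>2 * B\<close>; passing from the sets to
    \<open>\<sigma>\<close> adds \<open>2 * B\<close>.\<close>
  have near: "pdist h a b \<le> 4 * B"
    if a: "a \<in> carrier G" "?near a" and b: "b \<in> carrier G" "?near b" for a b
  proof -
    obtain u v where uv: "u \<in> coset_proj G \<pi> h {a}" "v \<in> coset_proj G \<pi> h {b}"
      using coset_proj_nonempty[OF h(1) a(1)] coset_proj_nonempty[OF h(1) b(1)] by blast
    have "h' \<otimes> \<one> \<in> h' <#\<^bsub>G\<^esub> \<gamma>"
      unfolding l_coset_def using subgroup.one_closed[OF subgroup_\<gamma>] by blast
    then have "h' \<in> h' <#\<^bsub>G\<^esub> \<gamma>" using h(2) by simp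
    then obtain c where c: "c \<in> coset_proj G \<pi> h (h' <#\<^bsub>G\<^esub> \<gamma>)"
      using coset_proj_nonempty[OF h(1,2)] by (auto simp: coset_proj_def)
    have "ennreal (dX u c) \<le> ennreal B" "ennreal (dX v c) \<le> ennreal B"
      using coset_dist_upper[OF uv(1) c] coset_dist_upper[OF uv(2) c] a b by auto
    then have "dX u c \<le> B" "dX v c \<le> B" using B_nonneg by (auto simp: ennreal_le_iff)
    then show ?thesis
      using pdist_le_of_coset_proj[OF h(1) a(1) b(1) uv]
        dist_triangle[of "\<phi> u x0" "\<phi> v x0" "\<phi> c x0"] by (simp add: dist_commute)
  qed
  have notnear: "pdist h' a b \<le> 4 * B"
    if a: "a \<in> carrier G" "\<not> ?near a" and b: "b \<in> carrier G" "\<not> ?near b" for a b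
  proof -
    have "coset_proj G \<pi> h' {a} = coset_proj G \<pi> h' {b}"
      using behrstock[OF a(1) h(1,2,3)] behrstock[OF b(1) h(1,2,3)] a b by simp
    moreover obtain u where "u \<in> coset_proj G \<pi> h' {a}"
      using coset_proj_nonempty[OF h(2) a(1)] by blast
    ultimately show ?thesis
      using pdist_le_of_coset_proj[OF h(2) a(1) b(1), of u u] B_nonneg by simp
  qed
  \<comment> \<open>At most one of the three points is near and at most one is not near, which is
    absurd.\<close>
  have "\<not> (?near x \<and> ?near y)" "\<not> (?near y \<and> ?near v)" "\<not> (?near x \<and> ?near v)"
    using near[OF x(1) _ x(2)] near[OF x(2) _ x(3)] near[OF x(1) _ x(3)] far by (meson not_less)+
  moreover have "\<not> (\<not> ?near x \<and> \<not> ?near y)" "\<not> (\<not> ?near y \<and> \<not> ?near v)"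
    "\<not> (\<not> ?near x \<and> \<not> ?near v)"
    using notnear[OF x(1) _ x(2)] notnear[OF x(2) _ x(3)] notnear[OF x(1) _ x(3)] far'
    by (meson not_less)+
  ultimately show False by argo
qed

section \<open>Representatives of cosets and the sets of large cosets\<close>

definition rep where "rep C = (SOME h. h \<in> carrier G \<and> h <#\<^bsub>G\<^esub> \<gamma> = C)"
definition cosets where "cosets = (\<lambda>h. h <#\<^bsub>G\<^esub> \<gamma>) ` carrier G"

lemma rep: "C \<in> cosets \<Longrightarrow> rep C \<in> carrier G \<and> rep C <#\<^bsub>G\<^esub> \<gamma> = C"
  unfolding rep_def cosets_def by (rule someI_ex) auto

text \<open>By \<open>coset_proj_cong\<close> the representative in the definition of
  \<open>large_cosets\<close> is immaterial, so membership can be tested at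
  \<open>rep C\<close>.\<close>

lemma large_cosets_iff:
  assumes "x \<in> carrier G" "y \<in> carrier G"
  shows "C \<in> large_cosets G \<phi> x0 \<gamma> \<pi> T x y \<longleftrightarrow>
    C \<in> cosets \<and> coset_dist G \<phi> x0 \<pi> (rep C) {x} {y} \<ge> ennreal T"
proof -
  have eq: "coset_dist G \<phi> x0 \<pi> (rep C) {x} {y} = coset_dist G \<phi> x0 \<pi> h {x} {y}"
    if "h \<in> carrier G" "C = h <#\<^bsub>G\<^esub> \<gamma>" for h
  proof -
    have "rep C \<in> carrier G" "rep C <#\<^bsub>G\<^esub> \<gamma> = h <#\<^bsub>G\<^esub> \<gamma>" using rep that by (auto simp: cosets_def)
    then show ?thesis
      using coset_proj_cong[OF subgroup_\<gamma> equivariant _ that(1)] assms by (simp add: coset_dist_def)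
  qed
  show ?thesis
  proof
    assume "C \<in> large_cosets G \<phi> x0 \<gamma> \<pi> T x y"
    then obtain h where h: "C = h <#\<^bsub>G\<^esub> \<gamma>" "h \<in> carrier G"
      "coset_dist G \<phi> x0 \<pi> h {x} {y} \<ge> ennreal T"
      by (auto simp: large_cosets_def)
    then show "C \<in> cosets \<and> coset_dist G \<phi> x0 \<pi> (rep C) {x} {y} \<ge> ennreal T"
      using eq[OF h(2,1)] by (simp add: cosets_def)
  next
    assume C: "C \<in> cosets \<and> coset_dist G \<phi> x0 \<pi> (rep C) {x} {y} \<ge> ennreal T"
    then have "rep C \<in> carrier G" "C = rep C <#\<^bsub>G\<^esub> \<gamma>" using rep by auto
    then show "C \<in> large_cosets G \<phi> x0 \<gamma> \<pi> T x y"
      unfolding large_cosets_def using C by (intro CollectI exI[of _ "rep C"]) simp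
  qed
qed

lemma large_cosets_pdist:
  assumes "x \<in> carrier G" "y \<in> carrier G" "C \<in> large_cosets G \<phi> x0 \<gamma> \<pi> T x y"
  shows "C \<in> cosets" "T - 2 * B \<le> pdist (rep C) x y"
proof -
  have *: "C \<in> cosets" "coset_dist G \<phi> x0 \<pi> (rep C) {x} {y} \<ge> ennreal T"
    using large_cosets_iff[OF assms(1,2)] assms(3) by auto
  show "C \<in> cosets" by fact
  show "T - 2 * B \<le> pdist (rep C) x y"
    using rep[OF *(1)] by (intro pdist_ge_of_coset_dist assms(1,2) *(2)) simp
qed

lemma pdist_large_cosets:
  assumes "x \<in> carrier G" "y \<in> carrier G" "C \<in> cosets" "U + 2 * B \<le> pdist (rep C) x y"
  shows "C \<in> large_cosets G \<phi> x0 \<gamma> \<pi> U x y"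
proof (rule ccontr)
  assume "\<not> ?thesis"
  then have "\<not> coset_dist G \<phi> x0 \<pi> (rep C) {x} {y} \<ge> ennreal U"
    using large_cosets_iff[OF assms(1,2)] assms(3) by simp
  from pdist_less_of_coset_dist[OF _ assms(1,2) this] show False
    using rep[OF assms(3)] assms(4) by simp
qed

section \<open>Windows of paths and their lengths\<close>

lemma pdist_step:
  assumes "h \<in> carrier G" "x \<in> carrier G" "y \<in> carrier G" "wd x y \<le> 1"
  shows "pdist h x y \<le> J"
proof -
  have "dX (inv h \<otimes> x) (inv h \<otimes> y) \<le> real (wd x y)"
    using orbit_lipschitz assms by (simp add: dX_left_mult)
  then show ?thesis
    unfolding pdist_def pr_def using assms by (intro \<sigma>_step) auto
qed

text \<open>Along the path the projection distance to \<open>p\<close> falls from at least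
  \<open>5 * V\<close> to below \<open>V\<close> by steps of at most \<open>J\<close>, so
  \<open>descent_window\<close> gives each coset its window. If two windows shared an index
  \<open>k\<close>, the points \<open>p\<close>, \<open>\<alpha> ! k\<close> and \<open>x\<close>
  would be pairwise far apart in both cosets, against
  \<open>no_common_separated_triple\<close>.\<close>

lemma crossing_windows:
  assumes path: "is_path G A x y \<alpha>" and p: "p \<in> carrier G"
    and V: "J \<le> V" "4 * B < V"
    and \<C>: "\<C> \<subseteq> cosets" "\<And>C. C \<in> \<C> \<Longrightarrow> 5 * V \<le> pdist (rep C) p x"
      "\<And>C. C \<in> \<C> \<Longrightarrow> pdist (rep C) p y < V"
  shows "\<exists>I K. finite \<C> \<and> (\<Sum>C\<in>\<C>. K C - I C) \<le> path_length \<alpha> \<and>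
    (\<forall>C\<in>\<C>. I C < K C \<and> K C \<le> path_length \<alpha> \<and>
      V \<le> pdist (rep C) (\<alpha> ! I C) (\<alpha> ! K C) \<and>
      (\<forall>k\<in>{I C..K C}. pdist (rep C) p (\<alpha> ! k) \<le> 4 * V))"
proof -
  let ?N = "path_length \<alpha>"
  have ends: "\<alpha> ! 0 = x" "\<alpha> ! ?N = y" "?N < length \<alpha>"
    using path by (auto simp: is_path_def path_length_def hd_conv_nth last_conv_nth)
  have carr: "\<alpha> ! k \<in> carrier G" if "k \<le> ?N" for k
    using path_nth_carrier[OF path] that ends(3) by simp
  have x: "x \<in> carrier G" using carr[of 0] ends by simp
  have V0: "V > 0" using V(2) B_nonneg by linarith
  have "\<exists>i k. i < k \<and> k \<le> ?N \<and> 3 * V \<le> pdist (rep C) p (\<alpha> ! i) \<and>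
      pdist (rep C) p (\<alpha> ! k) \<le> 2 * V \<and>
      (\<forall>l\<in>{i..k}. V \<le> pdist (rep C) p (\<alpha> ! l) \<and> pdist (rep C) p (\<alpha> ! l) \<le> 4 * V)"
    if C: "C \<in> \<C>" for C
  proof (rule descent_window[OF _ V(1) V0])
    fix l assume l: "l < ?N"
    have h: "rep C \<in> carrier G" using rep C \<C>(1) by blast
    have "wd (\<alpha> ! l) (\<alpha> ! Suc l) \<le> 1" using l ends(3) by (intro path_nth_step[OF path]) simp
    then have "pdist (rep C) (\<alpha> ! l) (\<alpha> ! Suc l) \<le> J"
      using l by (intro pdist_step h carr) auto
    then show "\<bar>pdist (rep C) p (\<alpha> ! Suc l) - pdist (rep C) p (\<alpha> ! l)\<bar> \<le> J"
      using pdist_triangle[of "rep C" p "\<alpha> ! l" "\<alpha> ! Suc l"]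
        pdist_triangle[of "rep C" p "\<alpha> ! Suc l" "\<alpha> ! l"]
        pdist_commute[of "rep C" "\<alpha> ! Suc l" "\<alpha> ! l"] by linarith
  next
    show "3 * V \<le> pdist (rep C) p (\<alpha> ! 0)" using \<C>(2)[OF C] ends V0 by simp
    show "pdist (rep C) p (\<alpha> ! ?N) < V" using \<C>(3)[OF C] ends by simp
  qed
  then obtain I K where IK: "\<And>C. C \<in> \<C> \<Longrightarrow> I C < K C \<and> K C \<le> ?N \<and>
      3 * V \<le> pdist (rep C) p (\<alpha> ! I C) \<and> pdist (rep C) p (\<alpha> ! K C) \<le> 2 * V \<and>
      (\<forall>l\<in>{I C..K C}. V \<le> pdist (rep C) p (\<alpha> ! l) \<and> pdist (rep C) p (\<alpha> ! l) \<le> 4 * V)"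
    by metis
  have disj: "{I C..K C} \<inter> {I C'..K C'} = {}" if C: "C \<in> \<C>" "C' \<in> \<C>" "C \<noteq> C'" for C C'
  proof (rule ccontr)
    assume "{I C..K C} \<inter> {I C'..K C'} \<noteq> {}"
    then obtain k where k: "k \<in> {I C..K C}" "k \<in> {I C'..K C'}" by blast
    \<comment> \<open>The initial height \<open>5 * V\<close> leaves a distance \<open>V\<close> to
      \<open>x\<close> even at the top height \<open>4 * V\<close> of a window.\<close>
    have sep: "4 * B < pdist (rep C) p (\<alpha> ! k) \<and> 4 * B < pdist (rep C) (\<alpha> ! k) x \<and>
        4 * B < pdist (rep C) p x" if "C \<in> \<C>" "k \<in> {I C..K C}" for C
    proof -
      have "V \<le> pdist (rep C) p (\<alpha> ! k)" "pdist (rep C) p (\<alpha> ! k) \<le> 4 * V"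
        using IK[OF that(1)] that(2) by auto
      then show ?thesis
        using \<C>(2)[OF that(1)] V(2) V0 pdist_triangle[of "rep C" p x "\<alpha> ! k"] by linarith
    qed
    have "k \<le> ?N" using k(1) IK[OF C(1)] by auto
    then show False
      using no_common_separated_triple[of "rep C" "rep C'" p "\<alpha> ! k" x] rep[of C] rep[of C']
        sep[OF C(1) k(1)] sep[OF C(2) k(2)] \<C>(1) C p x carr by auto
  qed
  have intervals: "I C < K C \<and> K C \<le> ?N" if "C \<in> \<C>" for C using IK[OF that] by blast
  show ?thesis
  proof (rule exI[of _ I], rule exI[of _ K], intro conjI ballI)
    show "finite \<C>" by (rule disjoint_intervals_total_length(1)[OF intervals disj])
    show "(\<Sum>C\<in>\<C>. K C - I C) \<le> ?N"
      by (rule disjoint_intervals_total_length(2)[OF intervals disj])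
    fix C assume C: "C \<in> \<C>"
    show "I C < K C" "K C \<le> ?N" using intervals[OF C] by auto
    show "V \<le> pdist (rep C) (\<alpha> ! I C) (\<alpha> ! K C)"
      using IK[OF C] pdist_triangle[of "rep C" p "\<alpha> ! I C" "\<alpha> ! K C"]
        pdist_commute[of "rep C" "\<alpha> ! K C" "\<alpha> ! I C"] by simp
    show "pdist (rep C) p (\<alpha> ! k) \<le> 4 * V" if "k \<in> {I C..K C}" for k
      using IK[OF C] that by blast
  qed
qed

text \<open>The windows on a geodesic from \<open>q\<close> to \<open>p\<close> are disjoint and
  each has at least one step.\<close>

lemma card_separating_cosets:
  assumes "p \<in> carrier G" "q \<in> carrier G" "J \<le> V" "4 * B < V"
    and "\<C> \<subseteq> cosets" "\<And>C. C \<in> \<C> \<Longrightarrow> 5 * V \<le> pdist (rep C) p q"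
  shows "finite \<C>" "card \<C> \<le> wd p q"
proof -
  have V0: "V > 0" using assms(4) B_nonneg by linarith
  \<comment> \<open>The geodesic ends at \<open>p\<close> itself, where the projection distance to
    \<open>p\<close> is 0.\<close>
  then have pp: "pdist (rep C) p p < V" for C by simp
  obtain \<beta> where \<beta>: "is_path G A q p \<beta>" "path_length \<beta> = wd q p"
    using geodesic_exists assms by blast
  obtain I K where IK: "\<And>C. C \<in> \<C> \<Longrightarrow> I C < K C \<and> K C \<le> path_length \<beta> \<and>
      V \<le> pdist (rep C) (\<beta> ! I C) (\<beta> ! K C)"
    and fin: "finite \<C>" and sum: "(\<Sum>C\<in>\<C>. K C - I C) \<le> path_length \<beta>"
    using crossing_windows[OF \<beta>(1) assms(1,3,4,5,6) pp] by blast
  show "finite \<C>" by fact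
  have "card \<C> = (\<Sum>C\<in>\<C>. 1)" by simp
  also have "\<dots> \<le> (\<Sum>C\<in>\<C>. K C - I C)" using IK by (intro sum_mono) fastforce
  also have "\<dots> \<le> wd p q" using sum \<beta>(2) word_dist_commute assms by simp
  finally show "card \<C> \<le> wd p q" .
qed

text \<open>Left translation by the inverse of \<open>rep C\<close> reduces to the axis, where the
  divergence of \<open>g0\<close> applies. Its threshold is in the word metric, which dominates
  \<open>pdist\<close> because the orbit map is 1-Lipschitz.\<close>

lemma divergent_window:
  assumes path: "is_path G A x y \<alpha>" and C: "C \<in> cosets" and ik: "i \<le> k" "k < length \<alpha>"
    and \<theta>: "\<theta> \<le> pdist (rep C) (\<alpha> ! i) (\<alpha> ! k)" and d: "d > 0"
    and avoid: "\<And>l a. l \<in> {i..k} \<Longrightarrow> a \<in> axis \<Longrightarrow> d < real (wd (inv (rep C) \<otimes> \<alpha> ! l) a)"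
  shows "f d \<le> real (k - i)"
proof -
  let ?h = "rep C"
  have h: "?h \<in> carrier G" using rep[OF C] by simp
  define \<beta> where "\<beta> = take (Suc (k - i)) (drop i \<alpha>)"
  note \<beta> = path_segment[OF path ik, folded \<beta>_def]
  have ends: "\<alpha> ! i \<in> carrier G" "\<alpha> ! k \<in> carrier G"
    using path_nth_carrier[OF path] ik by auto
  have "f d \<le> real (path_length (map ((\<otimes>) (inv ?h)) \<beta>))"
  proof (rule divergent)
    show "is_path G A (inv ?h \<otimes> \<alpha> ! i) (inv ?h \<otimes> \<alpha> ! k) (map ((\<otimes>) (inv ?h)) \<beta>)"
      using path_left_mult[OF \<beta>(1)] h by simp
    show "d < real (wd v a)" if "v \<in> set (map ((\<otimes>) (inv ?h)) \<beta>)" "a \<in> axis" for v a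
      using that \<beta>(3) avoid by auto
    have "pdist ?h (\<alpha> ! i) (\<alpha> ! k) \<le> real (wd (\<sigma> (inv ?h \<otimes> \<alpha> ! i)) (\<sigma> (inv ?h \<otimes> \<alpha> ! k)))"
      unfolding pdist_def pr_def[symmetric] using h ends by (intro orbit_lipschitz pr_carrier)
    then show "\<theta> \<le> real (wd (\<sigma> (inv ?h \<otimes> \<alpha> ! i)) (\<sigma> (inv ?h \<otimes> \<alpha> ! k)))"
      using \<theta> by simp
  qed (use h ends d in auto)
  then show ?thesis using \<beta>(2) by (simp add: path_length_def)
qed

text \<open>On a geodesic most windows are short, and a short window has to come close to its coset.\<close>

lemma card_remote_cosets:
  assumes p: "p \<in> carrier G" and q: "q \<in> carrier G"
    and V: "J \<le> V" "4 * B < V" "\<theta> \<le> V"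
    and \<C>: "\<C> \<subseteq> cosets" "\<And>C. C \<in> \<C> \<Longrightarrow> 5 * V \<le> pdist (rep C) p q"
    and d: "d > 0"
    and remote: "\<And>C a. C \<in> \<C> \<Longrightarrow> a \<in> axis \<Longrightarrow> d + real (wd p q) < real (wd (inv (rep C) \<otimes> p) a)"
  shows "real (card \<C>) * f d \<le> real (wd p q)"
proof -
  have V0: "V > 0" using V(2) B_nonneg by linarith
  then have pp: "pdist (rep C) p p < V" for C by simp
  obtain \<beta> where \<beta>: "is_path G A q p \<beta>" "path_length \<beta> = wd q p"
    using geodesic_exists p q by blast
  obtain I K where IK: "\<And>C. C \<in> \<C> \<Longrightarrow> I C < K C \<and> K C \<le> path_length \<beta> \<and>
      V \<le> pdist (rep C) (\<beta> ! I C) (\<beta> ! K C)"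
    and fin: "finite \<C>" and sum: "(\<Sum>C\<in>\<C>. K C - I C) \<le> path_length \<beta>"
    using crossing_windows[OF \<beta>(1) p V(1,2) \<C> pp] by blast
  have len: "path_length \<beta> < length \<beta>" and last: "\<beta> ! path_length \<beta> = p"
    using \<beta>(1) by (auto simp: is_path_def path_length_def last_conv_nth)
  have "f d \<le> real (K C - I C)" if C: "C \<in> \<C>" for C
  proof (rule divergent_window[OF \<beta>(1) _ _ _ _ d])
    show "C \<in> cosets" using C \<C> by blast
    then have h: "rep C \<in> carrier G" using rep by simp
    show "I C \<le> K C" "K C < length \<beta>" "\<theta> \<le> pdist (rep C) (\<beta> ! I C) (\<beta> ! K C)"
      using IK[OF C] len V(3) by auto
    fix l a assume l: "l \<in> {I C..K C}" and a: "a \<in> axis"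
    have l': "l \<le> path_length \<beta>" using l IK[OF C] by auto
    then have bl: "\<beta> ! l \<in> carrier G" using path_nth_carrier[OF \<beta>(1)] len by simp
    \<comment> \<open>The rest of the geodesic joins this vertex to \<open>p\<close>, so the vertex
      is within \<open>wd p q\<close> of \<open>p\<close>, and remoteness leaves more than
      \<open>d\<close>.\<close>
    have "wd (\<beta> ! l) p \<le> path_length \<beta> - l"
      using path_dist_nth[OF \<beta>(1) l' len] last by simp
    then have "wd (inv (rep C) \<otimes> p) (inv (rep C) \<otimes> \<beta> ! l) \<le> wd p q"
      using \<beta>(2) word_dist_commute p q bl h by (simp add: word_dist_left_mult)
    moreover have "wd (inv (rep C) \<otimes> p) a \<le>
        wd (inv (rep C) \<otimes> p) (inv (rep C) \<otimes> \<beta> ! l) + wd (inv (rep C) \<otimes> \<beta> ! l) a"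
      using h p bl a axis_carrier by (intro word_dist_triangle) auto
    ultimately show "d < real (wd (inv (rep C) \<otimes> \<beta> ! l) a)"
      using remote[OF C a] by linarith
  qed
  then have "(\<Sum>C\<in>\<C>. f d) \<le> (\<Sum>C\<in>\<C>. real (K C - I C))" by (intro sum_mono)
  also have "\<dots> = real (\<Sum>C\<in>\<C>. K C - I C)" by simp
  also have "\<dots> \<le> real (wd p q)"
    using sum unfolding \<beta>(2) word_dist_commute[OF q p] by (simp only: of_nat_le_iff)
  finally show ?thesis by simp
qed

text \<open>Suppose that, after translation, a window vertex \<open>v\<close> is within
  \<open>d\<close> of an axis point \<open>a\<close>, while \<open>p\<close> is within
  \<open>R\<close> of an axis point \<open>b\<close>. The projections of \<open>p\<close> and
  \<open>v\<close> are \<open>4 * V\<close>-close, and they are \<open>2 * R\<close>-close to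
  \<open>b\<close> and \<open>2 * d\<close>-close to \<open>a\<close>. So \<open>b\<close> and
  \<open>a\<close> are close in \<open>X\<close>, hence by \<open>\<kappa>\<close> in the word
  metric, and going from \<open>p\<close> over \<open>b\<close> and \<open>a\<close> to
  \<open>v\<close> contradicts \<open>avoid\<close>. Thus every window avoids the
  \<open>d\<close>-neighborhood and divergence applies to it.\<close>

lemma avoiding_path_length:
  assumes \<kappa>: "\<kappa> > 0" "\<And>a b. a \<in> axis \<Longrightarrow> b \<in> axis \<Longrightarrow> real (wd a b) \<le> \<kappa> * (dX a b + \<kappa>)"
    and path: "is_path G A x y \<alpha>" and p: "p \<in> carrier G"
    and V: "J \<le> V" "4 * B < V" "\<theta> \<le> V"
    and \<C>: "\<C> \<subseteq> cosets" "\<And>C. C \<in> \<C> \<Longrightarrow> 5 * V \<le> pdist (rep C) p x"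
      "\<And>C. C \<in> \<C> \<Longrightarrow> pdist (rep C) p y < V"
    and near: "\<And>C. C \<in> \<C> \<Longrightarrow> \<exists>b\<in>axis. real (wd (inv (rep C) \<otimes> p) b) \<le> R"
    and d: "d > 0"
    and avoid: "\<And>v. v \<in> set \<alpha> \<Longrightarrow> R + \<kappa> * (2 * d + 2 * R + 4 * V + \<kappa>) + d < real (wd p v)"
  shows "real (card \<C>) * max 1 (f d) \<le> real (path_length \<alpha>)"
proof -
  obtain I K where IK: "\<And>C. C \<in> \<C> \<Longrightarrow> I C < K C \<and> K C \<le> path_length \<alpha> \<and>
      V \<le> pdist (rep C) (\<alpha> ! I C) (\<alpha> ! K C)"
    and window: "\<And>C k. C \<in> \<C> \<Longrightarrow> k \<in> {I C..K C} \<Longrightarrow> pdist (rep C) p (\<alpha> ! k) \<le> 4 * V"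
    and fin: "finite \<C>" and sum: "(\<Sum>C\<in>\<C>. K C - I C) \<le> path_length \<alpha>"
    using crossing_windows[OF path p V(1,2) \<C>] by blast
  have len: "path_length \<alpha> < length \<alpha>"
    using path by (auto simp: is_path_def path_length_def)
  \<comment> \<open>The closest point to \<open>u\<close> is no farther from \<open>u\<close> than
    \<open>a\<close> is; the triangle inequality gives the factor 2.\<close>
  have nearest: "dX (\<sigma> u) a \<le> 2 * real (wd u a)" if "u \<in> carrier G" "a \<in> axis" for u a
  proof -
    have "dX u (\<sigma> u) \<le> dX u a" using X_projection_\<sigma> that by (simp add: X_projection_def)
    moreover have "dX u a \<le> real (wd u a)" using that axis_carrier by (intro orbit_lipschitz) auto
    ultimately show ?thesis
      using dist_triangle[of "\<phi> (\<sigma> u) x0" "\<phi> a x0" "\<phi> u x0"] by (simp add: dist_commute)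
  qed
  have long: "f d \<le> real (K C - I C)" if C: "C \<in> \<C>" for C
  proof (rule divergent_window[OF path _ _ _ _ d])
    show "C \<in> cosets" using C \<C> by blast
    then have h: "rep C \<in> carrier G" using rep by simp
    show "I C \<le> K C" "K C < length \<alpha>" "\<theta> \<le> pdist (rep C) (\<alpha> ! I C) (\<alpha> ! K C)"
      using IK[OF C] len V(3) by auto
    fix l a assume l: "l \<in> {I C..K C}" and a: "a \<in> axis"
    have l': "l < length \<alpha>" using l IK[OF C] len by auto
    then have v: "\<alpha> ! l \<in> carrier G" using path_nth_carrier[OF path] by simp
    obtain b where b: "b \<in> axis" "real (wd (inv (rep C) \<otimes> p) b) \<le> R" using near[OF C] by blast
    let ?p = "inv (rep C) \<otimes> p" and ?v = "inv (rep C) \<otimes> \<alpha> ! l"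
    have pv: "?p \<in> carrier G" "?v \<in> carrier G" using h p v by auto
    have ab: "a \<in> carrier G" "b \<in> carrier G" using a b axis_carrier by auto
    show "d < real (wd ?v a)"
    proof (rule ccontr)
      assume "\<not> d < real (wd ?v a)"
      then have va: "real (wd ?v a) \<le> d" by simp
      have "dX (\<sigma> ?p) (\<sigma> ?v) \<le> 4 * V"
        using window[OF C l] by (simp add: pdist_def pr_def)
      then have "dX b a \<le> 2 * d + 2 * R + 4 * V"
        using nearest[OF pv(1) b(1)] nearest[OF pv(2) a] b(2) va
          dist_triangle[of "\<phi> b x0" "\<phi> a x0" "\<phi> (\<sigma> ?p) x0"]
          dist_triangle[of "\<phi> (\<sigma> ?p) x0" "\<phi> a x0" "\<phi> (\<sigma> ?v) x0"] by (simp add: dist_commute)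
      then have "\<kappa> * (dX b a + \<kappa>) \<le> \<kappa> * (2 * d + 2 * R + 4 * V + \<kappa>)"
        using \<kappa>(1) by (intro mult_left_mono) auto
      then have "real (wd b a) \<le> \<kappa> * (2 * d + 2 * R + 4 * V + \<kappa>)"
        using \<kappa>(2)[OF b(1) a] by linarith
      moreover have "wd ?p ?v \<le> wd ?p b + wd b a + wd a ?v"
        using word_dist_triangle[OF pv(1) ab(2) pv(2)] word_dist_triangle[OF ab(2,1) pv(2)] by linarith
      moreover have "wd a ?v = wd ?v a" using ab pv by (intro word_dist_commute)
      moreover have "wd ?p ?v = wd p (\<alpha> ! l)" using h p v by (intro word_dist_left_mult) auto
      ultimately have "real (wd p (\<alpha> ! l)) \<le> R + \<kappa> * (2 * d + 2 * R + 4 * V + \<kappa>) + d"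
        using b(2) va by linarith
      then show False using avoid[of "\<alpha> ! l"] l' by simp
    qed
  qed
  \<comment> \<open>A window has at least one step in any case, which keeps the bound positive even
    where \<open>f\<close> vanishes.\<close>
  have "max 1 (f d) \<le> real (K C - I C)" if "C \<in> \<C>" for C
  proof -
    have "1 \<le> K C - I C" using IK[OF that] by linarith
    then have "1 \<le> real (K C - I C)" by linarith
    then show ?thesis using long[OF that] by simp
  qed
  then have "(\<Sum>C\<in>\<C>. max 1 (f d)) \<le> (\<Sum>C\<in>\<C>. real (K C - I C))" by (intro sum_mono)
  also have "\<dots> = real (\<Sum>C\<in>\<C>. K C - I C)" by simp
  also have "\<dots> \<le> real (path_length \<alpha>)" using sum by (simp only: of_nat_le_iff)
  finally show ?thesis by simp
qed

end

section \<open>Counting large cosets\<close>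

lemma ecard_finite: "finite S \<Longrightarrow> ecard S = ennreal (real (card S))"
  by (simp add: ecard_def emeasure_count_space_finite ennreal_of_nat_eq_real_of_nat)

lemma ecard_mono: "S \<subseteq> S' \<Longrightarrow> ecard S \<le> ecard S'"
  unfolding ecard_def by (rule emeasure_mono) auto

context coset_projections
begin

abbreviation large where "large \<equiv> large_cosets G \<phi> x0 \<gamma> \<pi>"

lemma large_cosets_separating:
  assumes "p \<in> carrier G" "q \<in> carrier G" "4 * B < V"
  shows "large (6 * V + 2 * B) p q \<subseteq> cosets"
    "C \<in> large (6 * V + 2 * B) p q \<Longrightarrow> 6 * V \<le> pdist (rep C) p q"
  using large_cosets_pdist[OF assms(1,2), of _ "6 * V + 2 * B"] by (auto simp: subset_iff)

lemma card_large_cosets: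
  assumes "p \<in> carrier G" "q \<in> carrier G" "J \<le> V" "4 * B < V"
  shows "finite (large (6 * V + 2 * B) p q)"
    "card (large (6 * V + 2 * B) p q) \<le> wd p q"
proof -
  have "5 * V \<le> pdist (rep C) p q" if "C \<in> large (6 * V + 2 * B) p q" for C
    using large_cosets_separating(2)[OF assms(1,2,4) that] assms(4) B_nonneg by linarith
  from card_separating_cosets[OF assms large_cosets_separating(1)[OF assms(1,2,4)] this]
  show "finite (large (6 * V + 2 * B) p q)"
    "card (large (6 * V + 2 * B) p q) \<le> wd p q" by blast+
qed

text \<open>Together with the first probabilistic hypothesis this yields displacement from
  \<open>p\<close> at least linear in time.\<close>

lemma word_dist_ge_ecard_large:
  assumes "p \<in> carrier G" "q \<in> carrier G" "J \<le> V" "4 * B < V"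
    and "ennreal t \<le> ecard (large (6 * V + 2 * B) p q)"
  shows "t \<le> real (wd p q)"
proof -
  have "ennreal t \<le> ennreal (real (card (large (6 * V + 2 * B) p q)))"
    using assms(5) ecard_finite[OF card_large_cosets(1)[OF assms(1-4)]] by simp
  then have "t \<le> real (card (large (6 * V + 2 * B) p q))" by (simp add: ennreal_le_iff)
  then show ?thesis using card_large_cosets(2)[OF assms(1-4)] by linarith
qed

text \<open>In the application \<open>q\<close>, \<open>x\<close>, \<open>y\<close> are w_m, w_n,
  z_n. From the cosets separating \<open>p\<close> from \<open>q\<close> three families are removed:
  those remote from \<open>p\<close> (\<open>N1\<close>), those still separating \<open>q\<close>
  from \<open>x\<close> (\<open>N2\<close>), and those separating \<open>p\<close> from
  \<open>y\<close> (\<open>N3\<close>). The rest satisfy \<open>avoiding_path_length\<close> with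
  \<open>d = m\<close> and \<open>R = d0 + L * m\<close>.\<close>

lemma path_length_lower_bound:
  assumes \<kappa>: "\<kappa> > 0" "\<And>a b. a \<in> axis \<Longrightarrow> b \<in> axis \<Longrightarrow> real (wd a b) \<le> \<kappa> * (dX a b + \<kappa>)"
    and V: "J \<le> V" "4 * B < V" "\<theta> \<le> V"
    and carr: "p \<in> carrier G" "q \<in> carrier G" "x \<in> carrier G" "y \<in> carrier G"
    and m: "m > 0" and \<epsilon>: "\<epsilon> > 0"
    and many: "ennreal (\<epsilon> * m) \<le> ecard (large (6 * V + 2 * B) p q)"
    and reach: "real (wd p q) \<le> L * m"
    and progress: "\<not> ecard (large (V - 2 * B) p q \<inter> large (V - 2 * B) q x) > ennreal (\<epsilon> * m / 8)"
    and separate: "\<not> ecard (large (V - 2 * B) x p \<inter> large (V - 2 * B) p y) > ennreal (\<epsilon> * m / 8)"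
    and d0: "d0 > 0" "f d0 > 0" "2 * L \<le> \<epsilon> * f d0"
    and path: "is_path G A x y \<alpha>"
    and avoid: "\<And>v. v \<in> set \<alpha> \<Longrightarrow>
      d0 + L * m + \<kappa> * (2 * m + 2 * (d0 + L * m) + 4 * V + \<kappa>) + m < real (wd p v)"
  shows "\<epsilon> * m / 4 * max 1 (f m) \<le> real (path_length \<alpha>)"
proof -
  \<comment> \<open>Membership at level \<open>?T\<close> gives projection distance at least
    \<open>6 * V\<close>; failure at level \<open>?U\<close> gives less than
    \<open>V\<close>.\<close>
  let ?T = "6 * V + 2 * B" and ?U = "V - 2 * B"
  have V0: "V > 0" using V(2) B_nonneg by linarith
  define N where "N = large ?T p q"
  have N: "N \<subseteq> cosets" "\<And>C. C \<in> N \<Longrightarrow> 6 * V \<le> pdist (rep C) p q" "finite N"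
    using large_cosets_separating[OF carr(1,2) V(2)] card_large_cosets(1)[OF carr(1,2) V(1,2)]
    by (auto simp: N_def)
  have "ennreal (\<epsilon> * m) \<le> ennreal (real (card N))"
    using many N(3) by (simp add: N_def ecard_finite)
  then have cardN: "\<epsilon> * m \<le> real (card N)" by (simp add: ennreal_le_iff)
  have small: "real (card S) \<le> \<epsilon> * m / 8"
    if "S \<subseteq> N" "S \<subseteq> S'" "\<not> ecard S' > ennreal (\<epsilon> * m / 8)" for S S'
  proof -
    have "finite S" using that(1) N(3) finite_subset by blast
    then have "ennreal (real (card S)) \<le> ennreal (\<epsilon> * m / 8)"
      using that ecard_mono[OF that(2)] ecard_finite[of S] by simp
    then show ?thesis using m \<epsilon> by (simp add: ennreal_le_iff)
  qed
  define N1 where "N1 = {C \<in> N. \<forall>a\<in>axis. d0 + real (wd p q) < real (wd (inv (rep C) \<otimes> p) a)}"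
  have "real (card N1) * f d0 \<le> real (wd p q)"
  proof (rule card_remote_cosets[OF carr(1,2) V _ _ d0(1)])
    show "N1 \<subseteq> cosets" using N(1) by (auto simp: N1_def)
    show "5 * V \<le> pdist (rep C) p q" if "C \<in> N1" for C
      using N(2)[of C] that V0 by (simp add: N1_def)
  qed (auto simp: N1_def)
  also have "\<dots> \<le> L * m" by (rule reach)
  \<comment> \<open>The largeness of \<open>f d0\<close> is what limits the remote cosets to half of
    the guaranteed number.\<close>
  also have "\<dots> \<le> \<epsilon> * f d0 / 2 * m" using d0(3) m by (intro mult_right_mono) auto
  finally have "real (card N1) * f d0 \<le> (\<epsilon> * m / 2) * f d0" by (simp add: mult_ac)
  then have card1: "real (card N1) \<le> \<epsilon> * m / 2" using d0(2) by (rule mult_right_le_imp_le)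
  define N2 where "N2 = N \<inter> large ?U q x"
  have "C \<in> large ?U p q" if "C \<in> N" for C
    using N(2)[OF that] N(1) that carr V0 by (intro pdist_large_cosets) auto
  then have card2: "real (card N2) \<le> \<epsilon> * m / 8"
    by (intro small[OF _ _ progress]) (auto simp: N2_def)
  \<comment> \<open>At least \<open>6 * V\<close> between \<open>p\<close> and \<open>q\<close>,
    minus less than \<open>V\<close> between \<open>q\<close> and \<open>x\<close>.\<close>
  have px: "5 * V \<le> pdist (rep C) p x" if "C \<in> N" "C \<notin> N2" for C
  proof -
    have "C \<notin> large ?U q x" using that by (simp add: N2_def)
    then have "pdist (rep C) q x < V"
      using pdist_large_cosets[OF carr(2,3), of C ?U] N(1) that(1) by force
    then show ?thesis
      using N(2)[OF that(1)] pdist_triangle[of "rep C" p q x] pdist_commute[of "rep C" x q] by linarith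
  qed
  \<comment> \<open>Only outside \<open>N2\<close> is \<open>x\<close> known to be far from
    \<open>p\<close>, as membership in \<open>large ?U x p\<close> requires.\<close>
  define N3 where "N3 = (N - N2) \<inter> large ?U p y"
  have "C \<in> large ?U x p" if "C \<in> N - N2" for C
    using px[of C] N(1) that carr V0 pdist_commute[of "rep C" x p] by (intro pdist_large_cosets) auto
  then have card3: "real (card N3) \<le> \<epsilon> * m / 8"
    by (intro small[OF _ _ separate]) (auto simp: N3_def)
  define \<C> where "\<C> = N - (N1 \<union> N2 \<union> N3)"
  have "card N - card (N1 \<union> N2 \<union> N3) \<le> card \<C>"
    unfolding \<C>_def by (rule diff_card_le_card_Diff) (use N(3) in \<open>auto simp: N1_def N2_def N3_def\<close>)
  moreover have "card (N1 \<union> N2 \<union> N3) \<le> card N1 + card N2 + card N3"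
    using card_Un_le[of "N1 \<union> N2" N3] card_Un_le[of N1 N2] by linarith
  ultimately have "real (card N) \<le> real (card \<C>) + (real (card N1) + real (card N2) + real (card N3))"
    by linarith
  \<comment> \<open>What survives is the fraction 1 - 1/2 - 1/8 - 1/8 = 1/4.\<close>
  then have card\<C>: "\<epsilon> * m / 4 \<le> real (card \<C>)"
    using cardN card1 card2 card3 by (simp add: field_simps)
  have "real (card \<C>) * max 1 (f m) \<le> real (path_length \<alpha>)"
  proof (rule avoiding_path_length[OF \<kappa> path carr(1) V _ _ _ _ m avoid])
    show "\<C> \<subseteq> cosets" using N(1) by (auto simp: \<C>_def)
    fix C assume C: "C \<in> \<C>"
    then have C': "C \<in> N" "C \<notin> N1" "C \<notin> N2" "C \<notin> N3" "C \<in> cosets" using N(1) by (auto simp: \<C>_def)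
    show "5 * V \<le> pdist (rep C) p x" by (rule px[OF C'(1,3)])
    have "C \<notin> large ?U p y" using C' by (simp add: N3_def)
    then show "pdist (rep C) p y < V"
      using pdist_large_cosets[OF carr(1,4) C'(5), of ?U] by force
    obtain b where "b \<in> axis" "real (wd (inv (rep C) \<otimes> p) b) \<le> d0 + real (wd p q)"
      using C'(1,2) by (auto simp: N1_def not_less)
    then show "\<exists>b\<in>axis. real (wd (inv (rep C) \<otimes> p) b) \<le> d0 + L * m"
      using reach by (intro bexI[of _ b]) auto
  qed
  moreover have "\<epsilon> * m / 4 * max 1 (f m) \<le> real (card \<C>) * max 1 (f m)"
    using card\<C> by (intro mult_right_mono) auto
  ultimately show ?thesis by linarith
qed

end

section \<open>Markov chains\<close>

text \<open>The law of the position after \<open>n\<close> steps. Splitting off the first step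
  matches the extension of cylinders by one time in \<open>emeasure_cyl_Int\<close>.\<close>

primrec kernel_pow :: "('g \<Rightarrow> 'g pmf) \<Rightarrow> nat \<Rightarrow> 'g \<Rightarrow> 'g pmf" where
  "kernel_pow K 0 p = return_pmf p"
| "kernel_pow K (Suc n) p = bind_pmf (K p) (kernel_pow K n)"

lemma set_kernel_pow:
  assumes "\<And>g. g \<in> S \<Longrightarrow> set_pmf (K g) \<subseteq> S" "p \<in> S"
  shows "set_pmf (kernel_pow K n p) \<subseteq> S"
  using assms(2)
proof (induction n arbitrary: p)
  case (Suc n)
  then show ?case using assms(1)[OF Suc.prems] by (auto simp: subset_iff)
qed simp

lemma nn_integral_bind_pmf:
  "(\<integral>\<^sup>+ y. g y \<partial>measure_pmf (bind_pmf P F)) = (\<integral>\<^sup>+ x. \<integral>\<^sup>+ y. g y \<partial>measure_pmf (F x) \<partial>measure_pmf P)"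
  unfolding measure_pmf_bind
  by (subst nn_integral_bind[where B="count_space UNIV"]) (auto simp: space_subprob_algebra
      intro!: prob_space_imp_subprob_space measure_pmf.prob_space_axioms)

text \<open>For values in a countable set, any relation \<open>R\<close> is a countable union of
  single pairs, each of which gives a measurable event.\<close>

lemma measurable_discrete_pair:
  assumes "countable S" "U \<in> M \<rightarrow>\<^sub>M count_space S" "U' \<in> M \<rightarrow>\<^sub>M count_space S"
  shows "{\<omega>\<in>space M. R (U \<omega>) (U' \<omega>)} \<in> sets M"
proof -
  let ?I = "{i \<in> S \<times> S. R (fst i) (snd i)}"
  have "{\<omega>\<in>space M. R (U \<omega>) (U' \<omega>)} =
      (\<Union>i\<in>?I. (U -` {fst i} \<inter> space M) \<inter> (U' -` {snd i} \<inter> space M))"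
    using measurable_space[OF assms(2)] measurable_space[OF assms(3)] by auto
  also have "\<dots> \<in> sets M"
  proof (rule sets.countable_UN'')
    show "countable ?I" by (rule countable_subset[of _ "S \<times> S"]) (use assms(1) in auto)
    fix i assume "i \<in> ?I"
    then show "(U -` {fst i} \<inter> space M) \<inter> (U' -` {snd i} \<inter> space M) \<in> sets M"
      by (intro sets.Int measurable_sets[OF assms(2)] measurable_sets[OF assms(3)]) auto
  qed
  finally show ?thesis .
qed

section \<open>Finite-time laws of one chain\<close>

locale countable_markov_chain = prob_space M for M :: "'w measure" +
  fixes S :: "'g set" and K :: "'g \<Rightarrow> 'g pmf" and W :: "nat \<Rightarrow> 'w \<Rightarrow> 'g" and p :: 'g
  assumes countable_S: "countable S" and p_S: "p \<in> S"
    and K_S: "g \<in> S \<Longrightarrow> set_pmf (K g) \<subseteq> S"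
    and W_measurable [measurable]: "W n \<in> M \<rightarrow>\<^sub>M count_space S"
    and start: "prob {\<omega>\<in>space M. W 0 \<omega> = p} = 1"
    and markov: "(\<And>i. i \<le> Suc n \<Longrightarrow> x i \<in> S) \<Longrightarrow>
      prob {\<omega>\<in>space M. \<forall>i\<le>Suc n. W i \<omega> = x i} =
      prob {\<omega>\<in>space M. \<forall>i\<le>n. W i \<omega> = x i} * pmf (K (x n)) (x (Suc n))"
begin

definition cyl where "cyl n x = {\<omega>\<in>space M. \<forall>i\<le>n. W i \<omega> = x i}"

lemma W_S: "\<omega> \<in> space M \<Longrightarrow> W n \<omega> \<in> S"
  using measurable_space[OF W_measurable] by simp

lemma event_measurable: "{\<omega>\<in>space M. R (W n \<omega>) (W m \<omega>)} \<in> sets M"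
  by (rule measurable_discrete_pair[OF countable_S W_measurable W_measurable])

lemma cyl_measurable: "cyl n x \<in> sets M"
proof -
  have "cyl n x = (\<Inter>i\<in>{..n}. {\<omega>\<in>space M. W i \<omega> = x i})" by (auto simp: cyl_def)
  also have "\<dots> \<in> sets M"
    using event_measurable[of "\<lambda>a b. a = x n" n n for n] by (intro sets.finite_INT) auto
  finally show ?thesis .
qed

lemma emeasure_cyl_Suc:
  assumes "\<And>i. i \<le> n \<Longrightarrow> x i \<in> S" "y \<in> S"
  shows "emeasure M (cyl (Suc n) (x(Suc n := y))) = emeasure M (cyl n x) * ennreal (pmf (K (x n)) y)"
proof -
  have "cyl n (x(Suc n := y)) = cyl n x" by (auto simp: cyl_def)
  moreover have "(x(Suc n := y)) i \<in> S" if "i \<le> Suc n" for i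
    using that assms by (auto simp: le_Suc_eq)
  from markov[of n "x(Suc n := y)", OF this]
  have "prob (cyl (Suc n) (x(Suc n := y))) = prob (cyl n (x(Suc n := y))) * pmf (K (x n)) y"
    by (simp only: cyl_def fun_upd_same fun_upd_other[OF n_not_Suc_n])
  ultimately have "prob (cyl (Suc n) (x(Suc n := y))) = prob (cyl n x) * pmf (K (x n)) y" by simp
  then show ?thesis by (simp add: emeasure_eq_measure ennreal_mult')
qed

lemma emeasure_split:
  assumes "Q \<in> sets M"
  shows "emeasure M (cyl n x \<inter> Q) =
    (\<integral>\<^sup>+ y. emeasure M (cyl (Suc n) (x(Suc n := y)) \<inter> Q) \<partial>count_space S)"
proof -
  have "cyl n x \<inter> Q = (\<Union>y\<in>S. cyl (Suc n) (x(Suc n := y)) \<inter> Q)"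
    using W_S by (auto simp: cyl_def le_Suc_eq)
  also have "emeasure M \<dots> = (\<integral>\<^sup>+ y. emeasure M (cyl (Suc n) (x(Suc n := y)) \<inter> Q) \<partial>count_space S)"
    by (intro emeasure_UN_countable countable_S)
      (use cyl_measurable assms in \<open>auto simp: disjoint_family_on_def cyl_def\<close>)
  finally show ?thesis .
qed

text \<open>Here \<open>g\<close> is the conditional probability of \<open>Q\<close> given the
  history up to time \<open>m + k\<close>, assumed to depend on the last position only. Extending
  the cylinder by one step with the Markov property lowers \<open>k\<close> by one. Products replace
  conditional probabilities because cylinders may be null.\<close>

lemma emeasure_cyl_Int:
  assumes Q: "Q \<in> sets M"
    and base: "\<And>x. (\<And>i. i \<le> m + k \<Longrightarrow> x i \<in> S) \<Longrightarrow>
      emeasure M (cyl (m + k) x \<inter> Q) = emeasure M (cyl (m + k) x) * g (x (m + k))"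
    and x: "\<And>i. i \<le> m \<Longrightarrow> x i \<in> S"
  shows "emeasure M (cyl m x \<inter> Q) =
    emeasure M (cyl m x) * (\<integral>\<^sup>+ y. g y \<partial>measure_pmf (kernel_pow K k (x m)))"
  using base x
proof (induction k arbitrary: m x)
  case 0
  then show ?case by simp
next
  case (Suc k)
  let ?I = "\<lambda>y. \<integral>\<^sup>+ z. g z \<partial>measure_pmf (kernel_pow K k y)"
  have xm: "x m \<in> S" using Suc.prems(2) by simp
  have "emeasure M (cyl m x \<inter> Q) =
      (\<integral>\<^sup>+ y. emeasure M (cyl (Suc m) (x(Suc m := y)) \<inter> Q) \<partial>count_space S)"
    by (rule emeasure_split[OF Q])
  also have "\<dots> = (\<integral>\<^sup>+ y. emeasure M (cyl m x) * (ennreal (pmf (K (x m)) y) * ?I y) \<partial>count_space S)"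
  proof (rule nn_integral_cong)
    fix y assume "y \<in> space (count_space S)"
    then have y: "y \<in> S" by simp
    have "emeasure M (cyl (Suc m) (x(Suc m := y)) \<inter> Q) =
        emeasure M (cyl (Suc m) (x(Suc m := y))) * ?I ((x(Suc m := y)) (Suc m))"
      by (rule Suc.IH) (use Suc.prems y in \<open>auto simp: le_Suc_eq\<close>)
    then show "emeasure M (cyl (Suc m) (x(Suc m := y)) \<inter> Q) =
        emeasure M (cyl m x) * (ennreal (pmf (K (x m)) y) * ?I y)"
      using emeasure_cyl_Suc[OF Suc.prems(2) y] by (simp add: mult.assoc)
  qed
  also have "\<dots> = emeasure M (cyl m x) * (\<integral>\<^sup>+ y. ennreal (pmf (K (x m)) y) * ?I y \<partial>count_space S)"
    by (rule nn_integral_cmult) simp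
  \<comment> \<open>The kernel puts no mass outside \<open>S\<close>.\<close>
  also have "(\<integral>\<^sup>+ y. ennreal (pmf (K (x m)) y) * ?I y \<partial>count_space S) =
      (\<integral>\<^sup>+ y. ennreal (pmf (K (x m)) y) * ?I y \<partial>count_space UNIV)"
    using K_S[OF xm] by (intro nn_integral_count_space_eq) (auto simp: set_pmf_iff)
  also have "\<dots> = (\<integral>\<^sup>+ y. ?I y \<partial>measure_pmf (K (x m)))"
    by (rule nn_integral_measure_pmf[symmetric])
  also have "\<dots> = (\<integral>\<^sup>+ z. g z \<partial>measure_pmf (kernel_pow K (Suc k) (x m)))"
    by (simp add: nn_integral_bind_pmf)
  finally show ?case .
qed

text \<open>\<open>emeasure_cyl_Int\<close> is used twice: from time \<open>m + k\<close> back to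
  \<open>m\<close> with an indicator as \<open>g\<close>, then from time \<open>m\<close> back to 0
  with the resulting \<open>k\<close>-step probability as \<open>g\<close>.\<close>

lemma two_time_law:
  "emeasure M {\<omega>\<in>space M. R (W m \<omega>) (W (m + k) \<omega>)} =
    (\<integral>\<^sup>+ q. emeasure (measure_pmf (kernel_pow K k q)) {y. R q y} \<partial>measure_pmf (kernel_pow K m p))"
proof -
  have one: "emeasure M (cyl m x \<inter> {\<omega>\<in>space M. P (W (m + k) \<omega>)}) =
      emeasure M (cyl m x) * emeasure (measure_pmf (kernel_pow K k (x m))) {y. P y}"
    if x: "\<And>i. i \<le> m \<Longrightarrow> x i \<in> S" for P m k x
  proof -
    let ?Q = "{\<omega>\<in>space M. P (W (m + k) \<omega>)}"
    have "emeasure M (cyl m x \<inter> ?Q) =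
      emeasure M (cyl m x) * (\<integral>\<^sup>+ y. indicator {y. P y} y \<partial>measure_pmf (kernel_pow K k (x m)))"
    proof (rule emeasure_cyl_Int[OF _ _ x])
      show "?Q \<in> sets M" by (rule event_measurable[of "\<lambda>a b. P a"])
      show "emeasure M (cyl (m + k) x \<inter> ?Q) = emeasure M (cyl (m + k) x) * indicator {y. P y} (x (m + k))"
        for x
      proof (cases "P (x (m + k))")
        case True
        then have "cyl (m + k) x \<inter> ?Q = cyl (m + k) x" by (auto simp: cyl_def)
        then show ?thesis using True by simp
      next
        case False
        then have "cyl (m + k) x \<inter> ?Q = {}" by (auto simp: cyl_def)
        then show ?thesis using False by simp
      qed
    qed
    then show ?thesis by simp
  qed
  let ?Q = "{\<omega>\<in>space M. R (W m \<omega>) (W (m + k) \<omega>)}"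
  \<comment> \<open>The cylinder at time 0 has full measure, so intersecting with it changes
    nothing.\<close>
  have "emeasure M (cyl 0 (\<lambda>_. p) \<inter> ?Q) =
      emeasure M (cyl 0 (\<lambda>_. p)) *
        (\<integral>\<^sup>+ q. emeasure (measure_pmf (kernel_pow K k q)) {y. R q y} \<partial>measure_pmf (kernel_pow K m p))"
  proof (rule emeasure_cyl_Int[where m=0])
    show "?Q \<in> sets M" by (rule event_measurable)
    show "p \<in> S" by (rule p_S)
    fix x assume x: "\<And>i. i \<le> 0 + m \<Longrightarrow> x i \<in> S"
    have "cyl m x \<inter> ?Q = cyl m x \<inter> {\<omega>\<in>space M. R (x m) (W (m + k) \<omega>)}" by (auto simp: cyl_def)
    then show "emeasure M (cyl (0 + m) x \<inter> ?Q) =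
        emeasure M (cyl (0 + m) x) * emeasure (measure_pmf (kernel_pow K k (x (0 + m)))) {y. R (x (0 + m)) y}"
      using one[of m x "R (x m)" k] x by simp
  qed
  moreover have cyl0: "emeasure M (cyl 0 (\<lambda>_. p)) = 1"
    using start by (simp add: cyl_def emeasure_eq_measure)
  moreover have "emeasure M (cyl 0 (\<lambda>_. p) \<inter> ?Q) = emeasure M ?Q"
  proof (rule emeasure_eq_AE)
    have "AE \<omega> in M. \<omega> \<in> cyl 0 (\<lambda>_. p)"
      using cyl0 by (intro AE_prob_1) (simp add: emeasure_eq_measure)
    then show "AE \<omega> in M. (\<omega> \<in> cyl 0 (\<lambda>_. p) \<inter> ?Q) = (\<omega> \<in> ?Q)" by eventually_elim simp
  qed (use event_measurable cyl_measurable in auto)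
  ultimately show ?thesis by simp
qed

lemma one_time_law:
  "emeasure M {\<omega>\<in>space M. P (W n \<omega>)} = emeasure (measure_pmf (kernel_pow K n p)) {y. P y}"
  using two_time_law[of "\<lambda>_. P" 0 n] by simp

text \<open>A bound uniform in the intermediate position survives averaging over that position,
  whose law is carried by \<open>S\<close>.\<close>

lemma two_time_bound:
  assumes "\<And>q. q \<in> S \<Longrightarrow> measure (measure_pmf (kernel_pow K k q)) {y. R q y} \<le> c"
  shows "prob {\<omega>\<in>space M. R (W m \<omega>) (W (m + k) \<omega>)} \<le> c"
proof -
  have c: "c \<ge> 0" using assms[OF p_S] measure_nonneg order_trans by blast
  have "emeasure M {\<omega>\<in>space M. R (W m \<omega>) (W (m + k) \<omega>)} \<le>
      (\<integral>\<^sup>+ q. ennreal c \<partial>measure_pmf (kernel_pow K m p))"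
    unfolding two_time_law
  proof (rule nn_integral_mono_AE)
    have "emeasure (measure_pmf (kernel_pow K k q)) {y. R q y} \<le> ennreal c"
      if "q \<in> set_pmf (kernel_pow K m p)" for q
      using assms[of q] that set_kernel_pow[of S K, OF K_S p_S]
      by (auto simp: measure_pmf.emeasure_eq_measure intro: ennreal_leI)
    then show "AE q in measure_pmf (kernel_pow K m p).
        emeasure (measure_pmf (kernel_pow K k q)) {y. R q y} \<le> ennreal c"
      by (simp add: AE_measure_pmf_iff)
  qed
  then show ?thesis using c by (simp add: emeasure_eq_measure)
qed

lemma one_time_prob:
  "prob {\<omega>\<in>space M. P (W n \<omega>)} = measure (measure_pmf (kernel_pow K n p)) {y. P y}"
  using one_time_law[of P n] by (simp add: emeasure_eq_measure measure_pmf.emeasure_eq_measure)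

end

text \<open>Decompose by the value \<open>q\<close> of \<open>U\<close>: by independence each piece
  has probability at most \<open>c\<close> times that of \<open>U = q\<close>, and these sum to
  1.\<close>

lemma (in prob_space) independent_bound:
  assumes S: "countable S"
    and U: "U \<in> M \<rightarrow>\<^sub>M count_space S" and U': "U' \<in> M \<rightarrow>\<^sub>M count_space S"
    and indep: "\<And>q P. q \<in> S \<Longrightarrow> prob {\<omega>\<in>space M. U \<omega> = q \<and> P (U' \<omega>)} =
      prob {\<omega>\<in>space M. U \<omega> = q} * prob {\<omega>\<in>space M. P (U' \<omega>)}"
    and bound: "\<And>q. q \<in> S \<Longrightarrow> prob {\<omega>\<in>space M. R q (U' \<omega>)} \<le> c" and c: "c \<ge> 0"
  shows "prob {\<omega>\<in>space M. R (U \<omega>) (U' \<omega>)} \<le> c"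
proof -
  have X_S: "U \<omega> \<in> S" if "\<omega> \<in> space M" for \<omega> using measurable_space[OF U that] by simp
  have meas: "{\<omega>\<in>space M. U \<omega> = q \<and> P (U' \<omega>)} \<in> sets M" for q P
    by (rule measurable_discrete_pair[OF S U U'])
  have "{\<omega>\<in>space M. R (U \<omega>) (U' \<omega>)} = (\<Union>q\<in>S. {\<omega>\<in>space M. U \<omega> = q \<and> R q (U' \<omega>)})"
    using X_S by auto
  also have "emeasure M \<dots> = (\<integral>\<^sup>+ q. emeasure M {\<omega>\<in>space M. U \<omega> = q \<and> R q (U' \<omega>)} \<partial>count_space S)"
    by (intro emeasure_UN_countable S) (use meas in \<open>auto simp: disjoint_family_on_def\<close>)
  also have "\<dots> \<le> (\<integral>\<^sup>+ q. ennreal c * emeasure M {\<omega>\<in>space M. U \<omega> = q} \<partial>count_space S)"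
  proof (rule nn_integral_mono)
    fix q assume "q \<in> space (count_space S)"
    then have q: "q \<in> S" by simp
    have "prob {\<omega>\<in>space M. U \<omega> = q \<and> R q (U' \<omega>)} \<le> c * prob {\<omega>\<in>space M. U \<omega> = q}"
      unfolding indep[OF q] mult.commute[of c] by (intro mult_left_mono bound q) auto
    then have "ennreal (prob {\<omega>\<in>space M. U \<omega> = q \<and> R q (U' \<omega>)}) \<le>
        ennreal (c * prob {\<omega>\<in>space M. U \<omega> = q})" by (rule ennreal_leI)
    then show "emeasure M {\<omega>\<in>space M. U \<omega> = q \<and> R q (U' \<omega>)} \<le>
        ennreal c * emeasure M {\<omega>\<in>space M. U \<omega> = q}"
      using c by (simp add: emeasure_eq_measure ennreal_mult)
  qed
  also have "\<dots> = ennreal c * (\<integral>\<^sup>+ q. emeasure M {\<omega>\<in>space M. U \<omega> = q} \<partial>count_space S)"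
    by (rule nn_integral_cmult) simp
  also have "(\<integral>\<^sup>+ q. emeasure M {\<omega>\<in>space M. U \<omega> = q} \<partial>count_space S) =
      emeasure M (\<Union>q\<in>S. {\<omega>\<in>space M. U \<omega> = q})"
    using meas[of _ "\<lambda>_. True"]
    by (intro emeasure_UN_countable[symmetric] S) (auto simp: disjoint_family_on_def)
  also have "(\<Union>q\<in>S. {\<omega>\<in>space M. U \<omega> = q}) = space M" using X_S by auto
  finally show ?thesis
    using c by (simp add: emeasure_eq_measure prob_space)
qed

section \<open>Divergence of the trajectories\<close>

context coset_projections
begin

text \<open>The deterministic core, for an outcome outside all exceptional events. The counts for
  \<open>x\<close> and \<open>y\<close> bound \<open>dist_to_pair\<close> below by
  \<open>\<epsilon> * n\<close>, so \<open>radius\<close> places the ball to be avoided in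
  \<open>path_length_lower_bound\<close> inside the ball of the divergence.\<close>

lemma divergence_lower_bound:
  fixes m n :: nat
  assumes \<kappa>: "\<kappa> > 0" "\<And>a b. a \<in> axis \<Longrightarrow> b \<in> axis \<Longrightarrow> real (wd a b) \<le> \<kappa> * (dX a b + \<kappa>)"
    and V: "J \<le> V" "4 * B < V" "\<theta> \<le> V" and f: "mono_on {0<..} f"
    and carr: "p \<in> carrier G" "q \<in> carrier G" "x \<in> carrier G" "y \<in> carrier G"
    and \<epsilon>: "\<epsilon> > 0" and \<delta>: "\<delta> > 0" and d0: "d0 > 0" "f d0 > 0" "2 * L \<le> \<epsilon> * f d0"
    and n: "n > 0" and C: "C > 0" and m: "real n / C \<le> real m" "4 * real n < \<epsilon> * real m * C"
    and radius: "d0 + L * real m + \<kappa> * (2 * real m + 2 * (d0 + L * real m) + 4 * V + \<kappa>) + real m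
      < \<delta> * (\<epsilon> * real n)"
    and many: "ennreal (\<epsilon> * real m) \<le> ecard (large (6 * V + 2 * B) p q)"
      "ennreal (\<epsilon> * real n) \<le> ecard (large (6 * V + 2 * B) p x)"
      "ennreal (\<epsilon> * real n) \<le> ecard (large (6 * V + 2 * B) p y)"
    and reach: "real (wd p q) \<le> L * real m"
    and progress: "\<not> ecard (large (V - 2 * B) p q \<inter> large (V - 2 * B) q x) > ennreal (\<epsilon> * real m / 8)"
    and separate: "\<not> ecard (large (V - 2 * B) x p \<inter> large (V - 2 * B) p y) > ennreal (\<epsilon> * real m / 8)"
  shows "dist_to_pair G A p x y > 0 \<and>
    divergence G A x y p \<delta> > ennreal (real n * f (real n / C) / C)"
proof
  have far: "\<epsilon> * real n \<le> real (wd p x)" "\<epsilon> * real n \<le> real (wd p y)"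
    using word_dist_ge_ecard_large[OF carr(1,3) V(1,2) many(2)]
      word_dist_ge_ecard_large[OF carr(1,4) V(1,2) many(3)] by auto
  then have r: "\<epsilon> * real n \<le> real (dist_to_pair G A p x y)" by (simp add: dist_to_pair_def)
  moreover have "\<epsilon> * real n > 0" using \<epsilon> n by simp
  ultimately have "real (dist_to_pair G A p x y) > 0" by linarith
  then show "dist_to_pair G A p x y > 0" by simp
  have nC: "real n / C > 0" using n C by simp
  then have m0: "real m > 0" using m(1) by linarith
  let ?b = "\<epsilon> * real m / 4 * max 1 (f (real m))"
  have "f (real n / C) \<le> f (real m)"
    using nC m0 by (intro mono_onD[OF f _ _ m(1)]) auto
  then have "real n / C * f (real n / C) \<le> real n / C * max 1 (f (real m))"
    using nC by (intro mult_left_mono) auto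
  \<comment> \<open>The factor \<open>max 1 (f (real m))\<close> is positive, which makes the
    inequality strict even if \<open>f\<close> vanishes.\<close>
  also have "\<dots> < \<epsilon> * real m / 4 * max 1 (f (real m))"
    using m(2) C by (intro mult_strict_right_mono) (auto simp: field_simps)
  finally have less: "real n * f (real n / C) / C < ?b" by simp
  have "ennreal ?b \<le> divergence G A x y p \<delta>"
    unfolding divergence_def
  proof (rule INF_greatest)
    fix \<alpha>
    assume "\<alpha> \<in> {\<alpha>. is_path G A x y \<alpha> \<and>
      (\<forall>v\<in>set \<alpha>. \<not> real (wd p v) < \<delta> * real (dist_to_pair G A p x y))}"
    then have path: "is_path G A x y \<alpha>"
      and outside: "\<And>v. v \<in> set \<alpha> \<Longrightarrow> \<delta> * real (dist_to_pair G A p x y) \<le> real (wd p v)"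
      by (auto simp: not_less)
    have "\<delta> * (\<epsilon> * real n) \<le> \<delta> * real (dist_to_pair G A p x y)"
      using r \<delta> by (intro mult_left_mono) auto
    then have "?b \<le> real (path_length \<alpha>)"
      using radius outside
      by (intro path_length_lower_bound[OF \<kappa> V carr m0 \<epsilon> many(1) reach progress separate d0 path])
        force+
    then show "ennreal ?b \<le> ennreal (real (path_length \<alpha>))" by (rule ennreal_leI)
  qed
  moreover have "ennreal (real n * f (real n / C) / C) < ennreal ?b"
    using less \<epsilon> m0 by (intro ennreal_lessI) (auto intro!: mult_pos_pos)
  ultimately show "divergence G A x y p \<delta> > ennreal (real n * f (real n / C) / C)"
    by (rule less_le_trans[rotated])
qed

section \<open>Displacement of chains with bounded jumps\<close>

lemma kernel_pow_word_dist:
  assumes step: "\<And>g h. g \<in> carrier G \<Longrightarrow> h \<in> set_pmf (K g) \<Longrightarrow> h \<in> carrier G \<and> real (wd g h) \<le> L"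
    and "g \<in> carrier G" "h \<in> set_pmf (kernel_pow K n g)"
  shows "h \<in> carrier G \<and> real (wd g h) \<le> L * real n"
  using assms(2,3)
proof (induction n arbitrary: g)
  case (Suc n)
  then obtain g' where g': "g' \<in> set_pmf (K g)" "h \<in> set_pmf (kernel_pow K n g')" by auto
  from step[OF Suc.prems(1) g'(1)] have *: "g' \<in> carrier G" "real (wd g g') \<le> L" by auto
  from Suc.IH[OF *(1) g'(2)] have **: "h \<in> carrier G" "real (wd g' h) \<le> L * real n" by auto
  have "wd g h \<le> wd g g' + wd g' h" by (rule word_dist_triangle[OF Suc.prems(1) *(1) **(1)])
  then have "real (wd g h) \<le> real (wd g g') + real (wd g' h)" by linarith
  then show ?case using * ** by (simp add: algebra_simps)
qed simp

end

lemma (in generated_group) bounded_jumps_word_dist: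
  assumes "bounded_jumps G K"
  obtains L where "L > 0" "\<And>g h. g \<in> carrier G \<Longrightarrow> h \<in> set_pmf (K g) \<Longrightarrow>
    h \<in> carrier G \<and> real (wd g h) \<le> L"
proof -
  obtain S where S: "finite S" "S \<subseteq> carrier G"
    "\<And>g h. g \<in> carrier G \<Longrightarrow> h \<notin> g <#\<^bsub>G\<^esub> S \<Longrightarrow> pmf (K g) h = 0"
    using assms by (auto simp: bounded_jumps_def)
  \<comment> \<open>Inserting 1 keeps the set nonempty and \<open>L\<close> positive.\<close>
  define L where "L = real (Max (insert 1 (wlen ` S)))"
  have L: "real (wlen s) \<le> L" if "s \<in> S" for s
    unfolding L_def using S(1) that by (intro of_nat_mono Max_ge) auto
  have "real 1 \<le> L" unfolding L_def using S(1) by (intro of_nat_mono Max_ge) auto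
  then have "L > 0" by simp
  then show ?thesis
  proof (rule that)
    fix g h assume g: "g \<in> carrier G" and h: "h \<in> set_pmf (K g)"
    then have "h \<in> g <#\<^bsub>G\<^esub> S" using S(3)[OF g] by (auto simp: set_pmf_iff)
    then obtain s where s: "s \<in> S" "h = g \<otimes> s" by (auto simp: l_coset_def)
    then have "s \<in> carrier G" using S(2) by blast
    then show "h \<in> carrier G \<and> real (wd g h) \<le> L"
      using g s L[OF s(1)] by (simp add: word_dist_def m_assoc[symmetric])
  qed
qed

section \<open>From the hypotheses to the projection locale\<close>

lemma hausdorff_distance_singleton:
  assumes "hausdorff_distance S {y} \<le> ennreal r" "r \<ge> 0"
  shows "S \<noteq> {}" "x \<in> S \<Longrightarrow> dist x y \<le> r"
proof -
  have 1: "(SUP x\<in>S. ennreal (dist x y)) \<le> ennreal r" and 2: "(INF x\<in>S. ennreal (dist x y)) \<le> ennreal r"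
    using assms(1) by (auto simp: hausdorff_distance_def)
  \<comment> \<open>Over the empty set the infimum would be infinite.\<close>
  show "S \<noteq> {}" using 2 by (auto simp: top_unique)
  show "dist x y \<le> r" if "x \<in> S"
  proof -
    have "ennreal (dist x y) \<le> ennreal r" using 1 that by (auto simp: SUP_le_iff)
    then show ?thesis using assms(2) by (simp add: ennreal_le_iff)
  qed
qed

text \<open>The projection \<open>\<sigma>\<close> of the divergence condition and the projection
  \<open>\<rho>\<close> near \<open>\<pi>\<close> may differ, but only by \<open>J\<close>. So
  \<open>B + J\<close> serves as the new constant; raising the threshold only weakens the Behrstock
  condition.\<close>

lemma (in hyperbolic_action) coset_projections_exist:
  assumes f: "f_divergent G A \<phi> x0 f g0" and \<gamma>: "subgroup \<gamma> G"
    and \<pi>: "projection_family G \<phi> x0 g0 \<gamma> \<pi> B"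
  shows "\<exists>\<sigma> B' J \<theta>. coset_projections G A \<phi> x0 g0 \<gamma> \<pi> \<sigma> f B' J \<theta>"
proof -
  obtain \<sigma> \<theta> where \<sigma>: "X_projection G \<phi> x0 axis \<sigma>"
    and div: "\<forall>x\<in>carrier G. \<forall>y\<in>carrier G. \<forall>d>0. \<forall>\<alpha>.
          real (word_dist G A (\<sigma> x) (\<sigma> y)) \<ge> \<theta> \<longrightarrow> is_path G A x y \<alpha> \<longrightarrow>
          (\<forall>v\<in>set \<alpha>. \<forall>a\<in>axis. real (word_dist G A v a) > d) \<longrightarrow>
          real (path_length \<alpha>) \<ge> f d"
    using f unfolding f_divergent_def by blast
  obtain \<rho> where \<rho>: "X_projection G \<phi> x0 axis \<rho>"
    and haus: "\<And>x. x \<in> carrier G \<Longrightarrow>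
      hausdorff_distance ((\<lambda>g. \<phi> g x0) ` \<pi> x) ((\<lambda>g. \<phi> g x0) ` {\<rho> x}) \<le> ennreal B"
    and B: "B \<ge> 0" and equiv: "equivariant_map G \<gamma> \<pi>"
    and behr: "\<And>x h h'. x\<in>carrier G \<Longrightarrow> h\<in>carrier G \<Longrightarrow> h'\<in>carrier G \<Longrightarrow>
        h <#\<^bsub>G\<^esub> \<gamma> \<noteq> h' <#\<^bsub>G\<^esub> \<gamma> \<Longrightarrow>
        coset_dist G \<phi> x0 \<pi> h {x} (h' <#\<^bsub>G\<^esub> \<gamma>) > ennreal B \<Longrightarrow>
        coset_proj G \<pi> h' {x} = coset_proj G \<pi> h' (h <#\<^bsub>G\<^esub> \<gamma>)"
    using \<pi> unfolding projection_family_def by blast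
  obtain J where J: "J \<ge> 0" "\<And>\<rho> \<sigma> x y. \<lbrakk>X_projection G \<phi> x0 axis \<rho>; X_projection G \<phi> x0 axis \<sigma>;
    x \<in> carrier G; y \<in> carrier G; dX x y \<le> 1\<rbrakk> \<Longrightarrow> dX (\<rho> x) (\<sigma> y) \<le> J"
    using X_projections_close by blast
  have "coset_projections G A \<phi> x0 g0 \<gamma> \<pi> \<sigma> f (B + J) J \<theta>"
  proof (rule coset_projections.intro[OF hyperbolic_action_axioms coset_projections_axioms.intro];
      (rule \<gamma> equiv \<sigma>)?)
    fix x assume x: "x \<in> carrier G"
    note near = hausdorff_distance_singleton[OF haus[OF x, simplified image_insert image_empty] B]
    show "\<pi> x \<noteq> {}" using near(1) by blast
    fix u assume "u \<in> \<pi> x"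
    then have "dX u (\<rho> x) \<le> B" by (intro near(2)) blast
    moreover have "dX (\<rho> x) (\<sigma> x) \<le> J" by (rule J(2)[OF \<rho> \<sigma> x x]) simp
    ultimately show "dX u (\<sigma> x) \<le> B + J"
      using dist_triangle[of "\<phi> u x0" "\<phi> (\<sigma> x) x0" "\<phi> (\<rho> x) x0"] by linarith
  next
    fix x y assume "x \<in> carrier G" "y \<in> carrier G" "dX x y \<le> 1"
    then show "dX (\<sigma> x) (\<sigma> y) \<le> J" by (rule J(2)[OF \<sigma> \<sigma>])
  next
    fix x h h' assume *: "x \<in> carrier G" "h \<in> carrier G" "h' \<in> carrier G" "h <#\<^bsub>G\<^esub> \<gamma> \<noteq> h' <#\<^bsub>G\<^esub> \<gamma>"
      and less: "coset_dist G \<phi> x0 \<pi> h {x} (h' <#\<^bsub>G\<^esub> \<gamma>) > ennreal (B + J)"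
    have "ennreal B \<le> ennreal (B + J)" using J(1) by (intro ennreal_leI) simp
    from le_less_trans[OF this less]
    show "coset_proj G \<pi> h' {x} = coset_proj G \<pi> h' (h <#\<^bsub>G\<^esub> \<gamma>)"
      by (rule behr[OF *])
  next
    fix x y d \<alpha>
    assume "x \<in> carrier G" "y \<in> carrier G" "d > 0" "\<theta> \<le> real (wd (\<sigma> x) (\<sigma> y))" "is_path G A x y \<alpha>"
      "\<And>v a. v \<in> set \<alpha> \<Longrightarrow> a \<in> axis \<Longrightarrow> d < real (wd v a)"
    then show "f d \<le> real (path_length \<alpha>)" using div by blast
  qed
  then show ?thesis by blast
qed

section \<open>Union bound and the two processes\<close>

lemma (in prob_space) prob_ge_of_exceptions:
  assumes "E \<in> events" "finite I" "\<And>i. i \<in> I \<Longrightarrow> b i \<in> events"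
    and "space M - (\<Union>i\<in>I. b i) \<subseteq> E"
  shows "1 - (\<Sum>i\<in>I. prob (b i)) \<le> prob E"
proof -
  have "prob (space M - E) \<le> prob (\<Union>i\<in>I. b i)"
    using assms by (intro finite_measure_mono sets.finite_UN) auto
  also have "\<dots> \<le> (\<Sum>i\<in>I. prob (b i))"
    using assms by (intro finite_measure_subadditive_finite) auto
  finally show ?thesis using prob_compl[OF assms(1)] by simp
qed

lemma markov_chain_countable:
  assumes "markov_chain G K M w" "countable (carrier G)" "p \<in> carrier G"
    and "\<And>g. g \<in> carrier G \<Longrightarrow> set_pmf (K g) \<subseteq> carrier G"
  shows "countable_markov_chain M (carrier G) K (w p) p"
proof -
  have M: "prob_space M" using assms(1) by (simp add: markov_chain_def)
  show ?thesis
    unfolding countable_markov_chain_def countable_markov_chain_axioms_def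
    using assms M unfolding markov_chain_def by auto
qed

text \<open>Independence of whole trajectories is evaluated on events that depend on one coordinate
  of each.\<close>

lemma independent_processes_prob:
  assumes "independent_processes G M w z" "markov_chain G K M w" "markov_chain G K M z"
    and p: "p \<in> carrier G" and q: "q \<in> carrier G"
  shows "measure M {\<omega>\<in>space M. w p n \<omega> = q \<and> P (z p m \<omega>)} =
    measure M {\<omega>\<in>space M. w p n \<omega> = q} * measure M {\<omega>\<in>space M. P (z p m \<omega>)}"
proof -
  interpret prob_space M using assms(2) by (simp add: markov_chain_def)
  let ?N = "Pi\<^sub>M (UNIV :: nat set) (\<lambda>_. count_space (carrier G))"
  have iv: "indep_var ?N (\<lambda>\<omega> n. w p n \<omega>) ?N (\<lambda>\<omega> n. z p n \<omega>)"
    using assms(1) p by (simp add: independent_processes_def)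
  have meas: "{s \<in> space ?N. Q (s k)} \<in> sets ?N" for Q k
  proof -
    have "(\<lambda>s. s k) -` {y \<in> carrier G. Q y} \<inter> space ?N \<in> sets ?N"
      by (rule measurable_sets[OF measurable_component_singleton]) auto
    also have "(\<lambda>s. s k) -` {y \<in> carrier G. Q y} \<inter> space ?N = {s \<in> space ?N. Q (s k)}"
      by (auto simp: space_PiM PiE_iff)
    finally show ?thesis .
  qed
  have paths: "(\<lambda>n. w p n \<omega>) \<in> space ?N" "(\<lambda>n. z p n \<omega>) \<in> space ?N" if "\<omega> \<in> space M" for \<omega>
  proof -
    have "w p n \<omega> \<in> carrier G" "z p n \<omega> \<in> carrier G" for n
      using assms(2,3) p that unfolding markov_chain_def by (metis measurable_space space_count_space)+
    then show "(\<lambda>n. w p n \<omega>) \<in> space ?N" "(\<lambda>n. z p n \<omega>) \<in> space ?N" by (auto simp: space_PiM)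
  qed
  have "(\<lambda>\<omega>. (\<lambda>n. w p n \<omega>, \<lambda>n. z p n \<omega>)) -` ({s \<in> space ?N. s n = q} \<times> {s \<in> space ?N. P (s m)}) \<inter> space M
      = {\<omega>\<in>space M. w p n \<omega> = q \<and> P (z p m \<omega>)}"
    "(\<lambda>\<omega> n. w p n \<omega>) -` {s \<in> space ?N. s n = q} \<inter> space M = {\<omega>\<in>space M. w p n \<omega> = q}"
    "(\<lambda>\<omega> n. z p n \<omega>) -` {s \<in> space ?N. P (s m)} \<inter> space M = {\<omega>\<in>space M. P (z p m \<omega>)}"
    using paths by auto
  then show ?thesis
    using indep_varD[OF iv meas[of "\<lambda>y. y = q" n] meas[of P m]] by simp
qed

section \<open>Choice of constants and the exceptional events\<close>

context coset_projections
begin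

text \<open>With \<open>m\<close> a small multiple of \<open>n\<close>, all hypotheses of
  \<open>divergence_lower_bound\<close> hold outside six events of exponentially small or zero
  probability.\<close>

lemma divergence_estimate:
  assumes finite_A: "finite A"
    and f: "mono_on {0<..} f" "filterlim f at_top at_top"
    and w: "markov_chain G K M w" and z: "markov_chain G K M z"
    and indep: "independent_processes G M w z" and jumps: "bounded_jumps G K"
    and many: "\<exists>T0::real. \<forall>T\<ge>T0. \<exists>C0>0. \<exists>\<epsilon>0>0. \<forall>p\<in>carrier G. \<forall>n::nat.
           measure M {\<omega>\<in>space M. ecard (large T p (w p n \<omega>)) \<ge> ennreal (\<epsilon>0 * real n)}
           \<ge> 1 - C0 * exp (- real n / C0)"
    and few: "\<exists>T0'\<ge>0::real. \<forall>T\<ge>T0'. \<exists>C1>0. \<forall>q\<in>carrier G. \<forall>p\<in>carrier G. \<forall>m::nat. \<forall>t>0.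
           measure M {\<omega>\<in>space M. ecard (large T q p \<inter> large T p (w p m \<omega>)) > ennreal t}
           \<le> C1 * exp (- t / C1)"
    and \<delta>: "\<delta> > 0"
  shows "\<exists>C>0. \<forall>p\<in>carrier G. \<forall>n::nat.
    measure M {\<omega>\<in>space M. dist_to_pair G A p (w p n \<omega>) (z p n \<omega>) > 0 \<and>
      divergence G A (w p n \<omega>) (z p n \<omega>) p \<delta> > ennreal (real n * f (real n / C) / C)}
    \<ge> 1 - C * exp (- real n / C)"
proof -
  interpret prob_space M using w by (simp add: markov_chain_def)
  have countable_G: "countable (carrier G)" by (rule countable_carrier[OF finite_A])
  obtain \<kappa> where \<kappa>: "\<kappa> > 0"
    "\<And>a b. a \<in> axis \<Longrightarrow> b \<in> axis \<Longrightarrow> real (wd a b) \<le> \<kappa> * (dX a b + \<kappa>)"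
    using word_dist_axis by blast
  obtain L where L: "L > 0" "\<And>g h. g \<in> carrier G \<Longrightarrow> h \<in> set_pmf (K g) \<Longrightarrow>
      h \<in> carrier G \<and> real (wd g h) \<le> L"
    using bounded_jumps_word_dist[OF jumps] by blast
  obtain T0 where T0: "\<And>T. T \<ge> T0 \<Longrightarrow> \<exists>C0>0. \<exists>\<epsilon>0>0. \<forall>p\<in>carrier G. \<forall>n::nat.
      prob {\<omega>\<in>space M. ecard (large T p (w p n \<omega>)) \<ge> ennreal (\<epsilon>0 * real n)}
      \<ge> 1 - C0 * exp (- real n / C0)"
    using many by blast
  obtain T0' where T0': "\<And>T. T \<ge> T0' \<Longrightarrow> \<exists>C1>0. \<forall>q\<in>carrier G. \<forall>p\<in>carrier G. \<forall>m::nat. \<forall>t>0.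
      prob {\<omega>\<in>space M. ecard (large T q p \<inter> large T p (w p m \<omega>)) > ennreal t}
      \<le> C1 * exp (- t / C1)"
    using few by blast
  \<comment> \<open>Large enough for the geometric lemmas and for both levels
    \<open>6 * V + 2 * B\<close> and \<open>V - 2 * B\<close> to be admissible in the two
    hypotheses.\<close>
  define V where "V = Max {J, 4 * B + 1, \<theta>, 1, T0, T0' + 2 * B}"
  have "J \<le> V" "4 * B + 1 \<le> V" "\<theta> \<le> V" "1 \<le> V" "T0 \<le> V" "T0' + 2 * B \<le> V"
    unfolding V_def by (auto intro: Max_ge)
  then have V: "J \<le> V" "4 * B < V" "\<theta> \<le> V" and V1: "1 \<le> V"
    and T: "T0 \<le> 6 * V + 2 * B" "T0' \<le> V - 2 * B"
    using B_nonneg by linarith+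
  let ?T = "6 * V + 2 * B" and ?U = "V - 2 * B"
  obtain C0 \<epsilon> where C0: "C0 > 0" and \<epsilon>: "\<epsilon> > 0"
    and many: "\<And>p n. p \<in> carrier G \<Longrightarrow>
      prob {\<omega>\<in>space M. ecard (large ?T p (w p n \<omega>)) \<ge> ennreal (\<epsilon> * real n)}
      \<ge> 1 - C0 * exp (- real n / C0)"
    using T0[OF T(1)] by blast
  obtain C1 where C1: "C1 > 0"
    and few: "\<And>q p m t. q \<in> carrier G \<Longrightarrow> p \<in> carrier G \<Longrightarrow> t > 0 \<Longrightarrow>
      prob {\<omega>\<in>space M. ecard (large ?U q p \<inter> large ?U p (w p m \<omega>)) > ennreal t}
      \<le> C1 * exp (- t / C1)"
    using T0'[OF T(2)] by blast
  have "eventually (\<lambda>d. f d \<ge> 2 * L / \<epsilon> + 1 \<and> d > 0) at_top"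
    using f(2) eventually_gt_at_top[of "0::real"]
    by (auto simp: filterlim_at_top intro: eventually_conj)
  then obtain d0 where "f d0 \<ge> 2 * L / \<epsilon> + 1" and d0_pos: "d0 > 0"
    unfolding eventually_at_top_linorder by blast
  moreover have "2 * L / \<epsilon> > 0" using L \<epsilon> by simp
  ultimately have "f d0 > 0" "2 * L / \<epsilon> \<le> f d0" by linarith+
  then have d0: "d0 > 0" "f d0 > 0" "2 * L \<le> \<epsilon> * f d0"
    using d0_pos \<epsilon> by (auto simp: field_simps)
  \<comment> \<open>\<open>a\<close> and \<open>b\<close> are the slope in \<open>m\<close> and the
    constant term of the radius to be avoided. The choice of \<open>\<eta>\<close> makes the linear
    part at most half of \<open>\<delta> * \<epsilon> * n\<close> when \<open>m\<close> is at most
    \<open>\<eta> * n\<close>.\<close>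
  define a where "a = L + \<kappa> * (2 + 2 * L) + 1"
  define b where "b = d0 + \<kappa> * (2 * d0 + 4 * V + \<kappa>)"
  define \<eta> where "\<eta> = min 1 (\<delta> * \<epsilon> / (2 * a))"
  have a: "a > 0" using L(1) \<kappa>(1) by (simp add: a_def add_pos_pos)
  have \<eta>: "0 < \<eta>" "\<eta> \<le> 1" "a * \<eta> \<le> \<delta> * \<epsilon> / 2"
  proof -
    show "0 < \<eta>" "\<eta> \<le> 1" using a \<delta> \<epsilon> by (auto simp: \<eta>_def)
    have "a * \<eta> \<le> a * (\<delta> * \<epsilon> / (2 * a))" using a by (intro mult_left_mono) (auto simp: \<eta>_def)
    then show "a * \<eta> \<le> \<delta> * \<epsilon> / 2" using a by simp
  qed
  \<comment> \<open>The first summand ensures that rounding \<open>\<eta> * n\<close> down loses at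
    most half, the second that \<open>b\<close> is below the other half of the radius.\<close>
  define n1 where "n1 = 2 / \<eta> + \<bar>2 * b / (\<delta> * \<epsilon>)\<bar> + 1"
  \<comment> \<open>A sum of positive terms, so that each lower bound required of \<open>C\<close>
    is read off from one of them.\<close>
  define C where "C = 3 + n1 + 2 / \<eta> + (8 / (\<epsilon> * \<eta>) + 1) + (3 * C0 + 2 * C1) +
    (2 * C0 / \<eta> + C0 + 16 * C1 / (\<epsilon> * \<eta>))"
  have pos: "2 / \<eta> > 0" "8 / (\<epsilon> * \<eta>) > 0" "2 * C0 / \<eta> > 0" "16 * C1 / (\<epsilon> * \<eta>) > 0" "n1 > 0"
    using \<eta> \<epsilon> C0 C1 by (auto simp: n1_def intro!: add_pos_nonneg)
  have C: "C > 0" "3 \<le> C" "n1 \<le> C" "2 / \<eta> \<le> C" "8 / (\<epsilon> * \<eta>) < C" "3 * C0 + 2 * C1 \<le> C"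
    "2 * C0 / \<eta> \<le> C" "C0 \<le> C" "16 * C1 / (\<epsilon> * \<eta>) \<le> C"
    using pos C0 C1 unfolding C_def by linarith+
  have "prob {\<omega>\<in>space M. dist_to_pair G A p (w p n \<omega>) (z p n \<omega>) > 0 \<and>
      divergence G A (w p n \<omega>) (z p n \<omega>) p \<delta> > ennreal (real n * f (real n / C) / C)}
    \<ge> 1 - C * exp (- real n / C)" (is "prob ?E \<ge> _") if p: "p \<in> carrier G" for p n
  proof (cases "real n < n1")
    case True
    \<comment> \<open>For small \<open>n\<close> the claim is trivial: \<open>n\<close> is below
      \<open>C\<close>, which is at least 3, and 3 exceeds Euler's number, so the lower bound is not
      positive.\<close>
    then have "- 1 \<le> - real n / C" using C by (simp add: field_simps)
    then have "exp (- 1) \<le> exp (- real n / C)" by simp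
    moreover have "1 / 3 \<le> exp (- 1 :: real)"
      using exp_le by (simp add: exp_minus field_simps)
    ultimately have "1 / 3 \<le> exp (- real n / C)" by linarith
    then have "3 * (1 / 3) \<le> C * exp (- real n / C)"
      by (intro mult_mono C(2)) (use C(1) in auto)
    then have "1 - C * exp (- real n / C) \<le> 0" by simp
    also have "0 \<le> prob ?E" by simp
    finally show ?thesis .
  next
    case False
    then have n: "real n \<ge> n1" by simp
    define m where "m = nat \<lfloor>\<eta> * real n\<rfloor>"
    have \<eta>n: "2 \<le> \<eta> * real n"
    proof -
      have "2 / \<eta> \<le> real n" using n pos unfolding n1_def by linarith
      then show ?thesis using \<eta>(1) by (simp add: field_simps)
    qed
    then have m_le: "real m \<le> \<eta> * real n" and m_ge: "\<eta> * real n / 2 \<le> real m"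
      unfolding m_def by linarith+
    have n0: "real n > 0" using n pos by linarith
    have "\<eta> * real n \<le> real n" using \<eta>(2) n0 by simp
    then have mn: "m \<le> n" using m_le by linarith
    have m0: "real m > 0" using \<eta>n m_ge by linarith
    have chain: "countable_markov_chain M (carrier G) K (w q) q"
      "countable_markov_chain M (carrier G) K (z q) q" if "q \<in> carrier G" for q
      using markov_chain_countable[OF w countable_G that] markov_chain_countable[OF z countable_G that]
        L(2) by blast+
    interpret W: countable_markov_chain M "carrier G" K "w p" p by (rule chain(1)[OF p])
    interpret Z: countable_markov_chain M "carrier G" K "z p" p by (rule chain(2)[OF p])
    have event: "{\<omega>\<in>space M. R (w p i \<omega>) (z p j \<omega>)} \<in> events" for R i j
      by (rule measurable_discrete_pair[OF countable_G W.W_measurable Z.W_measurable])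
    let ?t = "\<epsilon> * real m / 8"
    \<comment> \<open>\<open>E1\<close>, \<open>E2\<close>, \<open>E3\<close>: too few cosets for
      w_m, w_n, z_n. \<open>E4\<close>: too much backtracking after time \<open>m\<close>.
      \<open>E5\<close>: the two trajectories share too many cosets. \<open>E6\<close>: too large a
      displacement.\<close>
    define E1 where "E1 = {\<omega>\<in>space M. \<not> ecard (large ?T p (w p m \<omega>)) \<ge> ennreal (\<epsilon> * real m)}"
    define E2 where "E2 = {\<omega>\<in>space M. \<not> ecard (large ?T p (w p n \<omega>)) \<ge> ennreal (\<epsilon> * real n)}"
    define E3 where "E3 = {\<omega>\<in>space M. \<not> ecard (large ?T p (z p n \<omega>)) \<ge> ennreal (\<epsilon> * real n)}"
    define E4 where "E4 = {\<omega>\<in>space M.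
      ecard (large ?U p (w p m \<omega>) \<inter> large ?U (w p m \<omega>) (w p n \<omega>)) > ennreal ?t}"
    define E5 where "E5 = {\<omega>\<in>space M.
      ecard (large ?U (w p n \<omega>) p \<inter> large ?U p (z p n \<omega>)) > ennreal ?t}"
    define E6 where "E6 = {\<omega>\<in>space M. \<not> real (wd p (w p m \<omega>)) \<le> L * real m}"
    have events: "E1 \<in> events" "E2 \<in> events" "E3 \<in> events" "E4 \<in> events" "E5 \<in> events" "E6 \<in> events"
      unfolding E1_def E2_def E3_def E4_def E5_def E6_def
      by (rule event W.event_measurable)+
    \<comment> \<open>Both processes have the kernel \<open>K\<close>, so hypotheses stated for
      \<open>w\<close> pass to \<open>z\<close>.\<close>
    have same_law: "prob {\<omega>\<in>space M. P (z p n \<omega>)} = prob {\<omega>\<in>space M. P (w p n \<omega>)}" for P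
      unfolding W.one_time_prob[of P] Z.one_time_prob[of P] ..
    have few_w: "prob {\<omega>\<in>space M. \<not> ecard (large ?T p (w p i \<omega>)) \<ge> ennreal (\<epsilon> * real i)}
        \<le> C0 * exp (- real i / C0)" for i
      using many[OF p, of i] prob_neg[OF event[of "\<lambda>x _. ecard (large ?T p x) \<ge> ennreal (\<epsilon> * real i)" i 0]]
      by simp
    have exp_le_C: "c * exp (- s) \<le> c * exp (- real n / C)" if "real n / C \<le> s" "c > 0" for c s
      using that by (intro mult_left_mono) auto
    have rate: "real n / C \<le> real n / c" if "c \<le> C" "c > 0" for c
      using that n0 by (intro frac_le) auto
    have rate_m: "real n / C \<le> real m / C0"
    proof -
      have "real n / C \<le> real n / (2 * C0 / \<eta>)"
        by (rule rate[OF C(7) pos(3)])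
      also have "\<dots> = (\<eta> * real n / 2) / C0" by simp
      also have "\<dots> \<le> real m / C0" using m_ge C0 by (intro divide_right_mono) auto
      finally show ?thesis .
    qed
    have rate_n: "real n / C \<le> real n / C0"
      by (rule rate[OF C(8) C0])
    have rate_t: "real n / C \<le> ?t / C1"
    proof -
      have "real n / C \<le> real n / (16 * C1 / (\<epsilon> * \<eta>))"
        by (rule rate[OF C(9) pos(4)])
      also have "\<dots> = (\<epsilon> * (\<eta> * real n / 2) / 8) / C1" by simp
      also have "\<dots> \<le> ?t / C1"
        using m_ge C1 \<epsilon> by (intro divide_right_mono mult_left_mono) auto
      finally show ?thesis .
    qed
    have P1: "prob E1 \<le> C0 * exp (- real n / C)"
      using few_w[of m] exp_le_C[OF rate_m C0] by (simp add: E1_def)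
    have P2: "prob E2 \<le> C0 * exp (- real n / C)"
      using few_w[of n] exp_le_C[OF rate_n C0] by (simp add: E2_def)
    have "prob E3 = prob E2"
      unfolding E2_def E3_def by (rule same_law)
    then have P3: "prob E3 \<le> C0 * exp (- real n / C)" using P2 by simp
    have t: "?t > 0" using \<epsilon> m0 by simp
    have P4: "prob E4 \<le> C1 * exp (- real n / C)"
    proof -
      have "prob {\<omega>\<in>space M.
          ecard (large ?U p (w p m \<omega>) \<inter> large ?U (w p m \<omega>) (w p (m + (n - m)) \<omega>)) > ennreal ?t}
        \<le> C1 * exp (- ?t / C1)"
      \<comment> \<open>Given the position \<open>q\<close> at time \<open>m\<close>, the remaining
        \<open>n - m\<close> steps follow a chain from \<open>q\<close>, and the second hypothesis
        is uniform in \<open>q\<close>.\<close>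
      proof (rule W.two_time_bound)
        fix q assume q: "q \<in> carrier G"
        interpret Q: countable_markov_chain M "carrier G" K "w q" q by (rule chain(1)[OF q])
        show "measure (measure_pmf (kernel_pow K (n - m) q))
            {y. ecard (large ?U p q \<inter> large ?U q y) > ennreal ?t} \<le> C1 * exp (- ?t / C1)"
          using few[OF p q t, of "n - m"]
            Q.one_time_prob[of "\<lambda>y. ecard (large ?U p q \<inter> large ?U q y) > ennreal ?t" "n - m"]
          by (simp only:)
      qed
      then show ?thesis
        using exp_le_C[OF rate_t C1] mn by (simp add: E4_def)
    qed
    have P5: "prob E5 \<le> C1 * exp (- real n / C)"
    proof -
      have "prob E5 \<le> C1 * exp (- ?t / C1)"
        unfolding E5_def
      \<comment> \<open>Given w_n = q, the position z_n keeps its law, and the second hypothesis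
        applies with \<open>q\<close> as the fixed point.\<close>
      proof (rule independent_bound[OF countable_G W.W_measurable Z.W_measurable])
        fix q assume q: "q \<in> carrier G"
        show "prob {\<omega>\<in>space M. w p n \<omega> = q \<and> P (z p n \<omega>)} =
            prob {\<omega>\<in>space M. w p n \<omega> = q} * prob {\<omega>\<in>space M. P (z p n \<omega>)}" for P
          by (rule independent_processes_prob[OF indep w z p q])
        show "prob {\<omega>\<in>space M. ecard (large ?U q p \<inter> large ?U p (z p n \<omega>)) > ennreal ?t}
            \<le> C1 * exp (- ?t / C1)"
          using few[OF q p t, of n]
            same_law[of "\<lambda>y. ecard (large ?U q p \<inter> large ?U p y) > ennreal ?t"]
          by (simp only:)
      qed (use C1 in simp)
      then show ?thesis using exp_le_C[OF rate_t C1] by simp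
    qed
    have P6: "prob E6 = 0"
    proof -
      have "measure (measure_pmf (kernel_pow K m p)) {y. \<not> real (wd p y) \<le> L * real m} = 0"
        using kernel_pow_word_dist[OF L(2) p] by (auto simp: measure_pmf_zero_iff)
      then show ?thesis unfolding E6_def by (simp only: W.one_time_prob[of "\<lambda>y. \<not> real (wd p y) \<le> L * real m"])
    qed
    have good: "\<omega> \<in> ?E"
      if \<omega>: "\<omega> \<in> space M" "\<omega> \<notin> E1" "\<omega> \<notin> E2" "\<omega> \<notin> E3" "\<omega> \<notin> E4" "\<omega> \<notin> E5" "\<omega> \<notin> E6" for \<omega>
    proof -
      have "dist_to_pair G A p (w p n \<omega>) (z p n \<omega>) > 0 \<and>
        divergence G A (w p n \<omega>) (z p n \<omega>) p \<delta> > ennreal (real n * f (real n / C) / C)"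
      proof (rule divergence_lower_bound[OF \<kappa> V f(1) p _ _ _ \<epsilon> \<delta> d0 _ C(1)])
        show "w p m \<omega> \<in> carrier G" "w p n \<omega> \<in> carrier G" "z p n \<omega> \<in> carrier G"
          using W.W_S Z.W_S \<omega>(1) by auto
        show "n > 0" using n0 by simp
        have "real n / C \<le> real n / (2 / \<eta>)"
          by (rule rate[OF C(4) pos(1)])
        also have "\<dots> = \<eta> * real n / 2" by simp
        finally show "real n / C \<le> real m" using m_ge by linarith
        have "4 * real n = (8 / (\<epsilon> * \<eta>)) * (\<epsilon> * (\<eta> * real n / 2))"
          using \<epsilon> \<eta>(1) by simp
        also have "\<dots> < C * (\<epsilon> * (\<eta> * real n / 2))"
          using C(5) \<epsilon> \<eta>(1) n0 by (intro mult_strict_right_mono) auto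
        also have "\<dots> \<le> C * (\<epsilon> * real m)"
          using m_ge \<epsilon> C(1) by (intro mult_left_mono) auto
        finally show "4 * real n < \<epsilon> * real m * C" by (simp add: mult_ac)
        have "d0 + L * real m + \<kappa> * (2 * real m + 2 * (d0 + L * real m) + 4 * V + \<kappa>) + real m
            = a * real m + b"
          by (simp add: a_def b_def algebra_simps)
        also have "a * real m \<le> a * (\<eta> * real n)" using a m_le by (intro mult_left_mono) auto
        also have "\<dots> \<le> \<delta> * \<epsilon> / 2 * real n"
          using mult_right_mono[OF \<eta>(3), of "real n"] by (simp add: mult.assoc)
        also have "b < \<delta> * \<epsilon> / 2 * real n"
        proof -
          have "2 * b / (\<delta> * \<epsilon>) < real n" using n pos(1) unfolding n1_def by linarith
          then show ?thesis using \<delta> \<epsilon> by (simp add: field_simps)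
        qed
        finally show "d0 + L * real m + \<kappa> * (2 * real m + 2 * (d0 + L * real m) + 4 * V + \<kappa>) + real m
            < \<delta> * (\<epsilon> * real n)" by simp
      qed (use \<omega> in \<open>simp_all add: E1_def E2_def E3_def E4_def E5_def E6_def\<close>)
      then show ?thesis using \<omega>(1) by blast
    qed
    \<comment> \<open>Indexed by position, so that the sum has six terms even if some of the sets
      coincide.\<close>
    have "1 - (\<Sum>i\<in>{..<6::nat}. prob ([E1, E2, E3, E4, E5, E6] ! i)) \<le> prob ?E"
    proof (rule prob_ge_of_exceptions)
      show "?E \<in> events" by (rule event)
      show "[E1, E2, E3, E4, E5, E6] ! i \<in> events" if "i \<in> {..<6}" for i
        using that events nth_mem[of i "[E1, E2, E3, E4, E5, E6]"] by auto
      have "(\<Union>i\<in>{..<6}. [E1, E2, E3, E4, E5, E6] ! i) = E1 \<union> E2 \<union> E3 \<union> E4 \<union> E5 \<union> E6"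
        by (auto simp: eval_nat_numeral lessThan_Suc)
      then show "space M - (\<Union>i\<in>{..<6}. [E1, E2, E3, E4, E5, E6] ! i) \<subseteq> ?E"
        using good by blast
    qed simp
    moreover have "(\<Sum>i\<in>{..<6::nat}. prob ([E1, E2, E3, E4, E5, E6] ! i)) =
        prob E1 + prob E2 + prob E3 + prob E4 + prob E5 + prob E6"
      by (simp add: eval_nat_numeral lessThan_Suc)
    moreover have "(3 * C0 + 2 * C1) * exp (- real n / C) \<le> C * exp (- real n / C)"
      using C(6) by (intro mult_right_mono) auto
    ultimately show ?thesis
      using P1 P2 P3 P4 P5 P6 by (simp add: algebra_simps)
  qed
  then show ?thesis using C(1) by blast
qed

end

theorem theorem3p3:
  fixes G :: "('g, 'b) monoid_scheme"
    and A :: "'g set"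
    and \<phi> :: "'g \<Rightarrow> 'x::metric_space \<Rightarrow> 'x"
    and x0 :: 'x
    and f :: "real \<Rightarrow> real"
    and g0 :: 'g
    and \<gamma> :: "'g set"
    and \<pi> :: "'g \<Rightarrow> 'g set"
    and B :: real
    and K :: "'g \<Rightarrow> 'g pmf"
    and M :: "'w measure"
    and w z :: "'g \<Rightarrow> nat \<Rightarrow> 'w \<Rightarrow> 'g"
  assumes "group G"
    and "finite A" "A \<subseteq> carrier G" "generate G A = carrier G"
    and "gromov_hyperbolic TYPE('x)"
    and "isometric_action G \<phi>"
    and "\<forall>g\<in>carrier G. \<forall>h\<in>carrier G. dist (\<phi> g x0) (\<phi> h x0) \<le> real (word_dist G A g h)"
    and "non_elementary G \<phi> x0"
    and "\<forall>d>0. f d \<ge> 0" "mono_on {0<..} f" "filterlim f at_top at_top"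
    and "f_divergent G A \<phi> x0 f g0"
    and "maximal_elementary G g0 \<gamma>"
    and "projection_family G \<phi> x0 g0 \<gamma> \<pi> B"
    and "markov_chain G K M w" "markov_chain G K M z"
    and "independent_processes G M w z"
    and "bounded_jumps G K"
    and "irreducible_chain G M w"
    and "\<exists>T0::real. \<forall>T\<ge>T0. \<exists>C0>0. \<exists>\<epsilon>0>0. \<forall>p\<in>carrier G. \<forall>n::nat.
           measure M {\<omega>\<in>space M.
             ecard (large_cosets G \<phi> x0 \<gamma> \<pi> T p (w p n \<omega>)) \<ge> ennreal (\<epsilon>0 * real n)}
           \<ge> 1 - C0 * exp (- real n / C0)"
    and "\<exists>T0'\<ge>0::real. \<forall>T\<ge>T0'. \<exists>C1>0. \<forall>q\<in>carrier G. \<forall>p\<in>carrier G. \<forall>m::nat. \<forall>t>0.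
           measure M {\<omega>\<in>space M.
             ecard (large_cosets G \<phi> x0 \<gamma> \<pi> T q p \<inter> large_cosets G \<phi> x0 \<gamma> \<pi> T p (w p m \<omega>))
               > ennreal t}
           \<le> C1 * exp (- t / C1)"
  shows "\<exists>\<delta>0. 0 < \<delta>0 \<and> \<delta>0 < 1 \<and> (\<forall>\<delta>. 0 < \<delta> \<and> \<delta> \<le> \<delta>0 \<longrightarrow>
           (\<exists>C>0. \<forall>p\<in>carrier G. \<forall>n::nat.
              measure M {\<omega>\<in>space M.
                dist_to_pair G A p (w p n \<omega>) (z p n \<omega>) > 0 \<and>
                divergence G A (w p n \<omega>) (z p n \<omega>) p \<delta>
                  > ennreal (real n * f (real n / C) / C)}
              \<ge> 1 - C * exp (- real n / C)))"
proof -
  interpret generated_group G A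
    using assms(1,3,4) by (simp add: generated_group_def generated_group_axioms_def)
  interpret hyperbolic_action G A \<phi> x0 g0
    using assms(5,6,7,12) by unfold_locales (auto simp: f_divergent_def)
  have "subgroup \<gamma> G" using assms(13) by (simp add: maximal_elementary_def)
  then obtain \<sigma> B' J \<theta> where "coset_projections G A \<phi> x0 g0 \<gamma> \<pi> \<sigma> f B' J \<theta>"
    using coset_projections_exist[OF assms(12) _ assms(14)] by blast
  \<comment> \<open>The estimate holds for every positive \<open>\<delta>\<close>, so any threshold
    in (0,1) can be chosen; \<open>C\<close> depends on \<open>\<delta>\<close>.\<close>
  from coset_projections.divergence_estimate[OF this assms(2,10,11,15,16,17,18,20,21)]
  show ?thesis by (intro exI[of _ "1 / 2"]) auto
qed

end
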